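(* Let $d\geq 3$, let $V$ be a finite-dimensional complex vector space, and let $F\in S^dV^*$ be a concise form of minimal border rank (i.e. $\underline{\mathbf r}(F)=\dim V$). Then the following four conditions are equivalent: (1) $\mathrm{Hess}(F)=0$ (identically); (2) $\mathrm{cr}(F)>\underline{\mathbf r}(F)$; (3) $\mathrm{sr}(F)>\underline{\mathbf r}(F)$; (4) $F$ is wild.
   Context: Work over $\mathbb C$. Let $\dim V=n+1$, $V^*=\langle x_0,\dots,x_n\rangle$, $S=\mathbb C[x_0,\dots,x_n]=S^\bullet V^*$, and let $T=\mathbb C[y_0,\dots,y_n]=S^\bullet V$ act on $S$ by differentiation, $y_i=\partial/\partial x_i$. For a nonzero form $F\in S^dV^*$, $\mathrm{Ann}(F)=\{h\in T: h\circ F=0\}$. $F$ is concise if $\mathrm{Ann}(F)$ contains no nonzero linear form. $\mathrm{Hess}(F)$ denotes the determinant of the Hessian matrix $[\partial^2F/\partial x_i\partial x_j]$. Let $X=\nu_d(\mathbb P^n)\subset\mathbb P(S^dV^* )$ be the $d$-th Veronese variety of $d$-th powers $[L^d]$, $L\in V^*$. The border rank $\underline{\mathbf r}(F)$ is the least $r$ with $[F]\in\sigma_r(X)$, the $r$-th secant variety (closure of the union of the spans of $r$ points of $X$). The cactus rank $\mathrm{cr}(F)$ is the least $r$ such that there is a zero-dimensional scheme $R\subset X$ of length $r$ with $[F]\in\langle R\rangle$ (linear span of $R$); equivalently, the saturated ideal $\mathcal J_R\subset T$ of $R$ (viewed in $\mathbb P^n\cong X$) satisfies $\mathcal J_R\subset\mathrm{Ann}(F)$.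 The smoothable rank $\mathrm{sr}(F)$ is defined in the same way, requiring in addition that $R$ is smoothable in $X$ (a flat limit of reduced schemes consisting of $r$ distinct points of $X$). $F$ is wild if $\mathrm{sr}(F)>\underline{\mathbf r}(F)$. *)

theory Defs
  imports "HOL-Analysis.Analysis" "HOL-Library.Poly_Mapping"
begin

text \<open>
  The finite index type \<open>'n\<close> labels a basis of \<open>V\<close>, so \<open>dim V = CARD('n)\<close>. The type \<open>'n cpoly\<close> of
  complex polynomials in variables indexed by \<open>'n\<close> serves both as \<open>S = S\<^sup>\<bullet> V*\<close> (variables
  \<open>x\<^sub>i\<close>) and as \<open>T = S\<^sup>\<bullet> V\<close> (variables \<open>y\<^sub>i\<close>); a vector of \<open>complex ^ 'n\<close> is the coordinate vector of
  an element of \<open>V*\<close>, so that nonzero vectors up to scalars are the points of \<open>P(V*) = P\<^sup>n\<close>, whose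
  homogeneous coordinate ring is \<open>T\<close>.
\<close>

type_synonym 'n cpoly = "('n \<Rightarrow>\<^sub>0 nat) \<Rightarrow>\<^sub>0 complex"

definition var :: "'n \<Rightarrow> 'n cpoly" where
  "var i = Poly_Mapping.single (Poly_Mapping.single i 1) 1"

definition pscale :: "complex \<Rightarrow> 'n cpoly \<Rightarrow> 'n cpoly" where
  "pscale c p = Poly_Mapping.single 0 c * p"

lemma vector_space_pscale: "vector_space pscale"
  by standard
    (simp_all add: pscale_def algebra_simps single_add mult_single flip: mult.assoc)

definition mdeg :: "('n::finite \<Rightarrow>\<^sub>0 nat) \<Rightarrow> nat" where
  "mdeg \<alpha> = (\<Sum>i\<in>UNIV. Poly_Mapping.lookup \<alpha> i)"

definition forms :: "nat \<Rightarrow> 'n::finite cpoly set" where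
  "forms d = {F. \<forall>\<alpha>\<in>Poly_Mapping.keys F. mdeg \<alpha> = d}"

definition hom_component :: "nat \<Rightarrow> 'n::finite cpoly \<Rightarrow> 'n cpoly" where
  "hom_component m h =
     (\<Sum>\<alpha>\<in>{\<alpha>\<in>Poly_Mapping.keys h. mdeg \<alpha> = m}. Poly_Mapping.single \<alpha> (Poly_Mapping.lookup h \<alpha>))"

definition peval :: "'n::finite cpoly \<Rightarrow> complex ^ 'n \<Rightarrow> complex" where
  "peval h v = (\<Sum>\<alpha>\<in>Poly_Mapping.keys h. Poly_Mapping.lookup h \<alpha> * (\<Prod>i\<in>UNIV. (v $ i) ^ Poly_Mapping.lookup \<alpha> i))"

definition linear_form :: "complex ^ 'n::finite \<Rightarrow> 'n cpoly" where
  "linear_form v = (\<Sum>i\<in>UNIV. pscale (v $ i) (var i))"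


subsection \<open>The action of \<open>T\<close> by differentiation\<close>

text \<open>
  The iterated partial derivative of exponent \<open>\<beta>\<close>. The coefficient for \<open>x\<^sup>\<alpha>\<close> is the product of
  the falling factorials \<open>\<alpha>\<^sub>i (\<alpha>\<^sub>i - 1) \<dots> (\<alpha>\<^sub>i - \<beta>\<^sub>i + 1)\<close>; it vanishes
  as soon as some \<open>\<beta>\<^sub>i > \<alpha>\<^sub>i\<close>, so truncated subtraction of exponents does no harm.
\<close>

definition pderivs :: "('n::finite \<Rightarrow>\<^sub>0 nat) \<Rightarrow> 'n cpoly \<Rightarrow> 'n cpoly" where
  "pderivs \<beta> F = (\<Sum>\<alpha>\<in>Poly_Mapping.keys F. Poly_Mapping.single (\<alpha> - \<beta>)
     (of_nat (\<Prod>i\<in>UNIV. \<Prod>k<Poly_Mapping.lookup \<beta> i. Poly_Mapping.lookup \<alpha> i - k) * Poly_Mapping.lookup F \<alpha>))"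

lemma falling_factorials_eq_0:
  assumes "\<not> (\<forall>i. Poly_Mapping.lookup \<beta> i \<le> Poly_Mapping.lookup \<alpha> i)"
  shows "(\<Prod>i\<in>UNIV. \<Prod>k<Poly_Mapping.lookup \<beta> (i::'n::finite). Poly_Mapping.lookup \<alpha> i - k) = (0::nat)"
proof -
  obtain i where "Poly_Mapping.lookup \<alpha> i < Poly_Mapping.lookup \<beta> i" using assms by (auto simp: not_le)
  then have "(\<Prod>k<Poly_Mapping.lookup \<beta> i. Poly_Mapping.lookup \<alpha> i - k) = 0"
    by (intro prod_zero) auto
  then show ?thesis by (intro prod_zero) auto
qed

lemma lookup_pderivs:
  fixes F :: "'n::finite cpoly"
  shows "Poly_Mapping.lookup (pderivs \<beta> F) \<gamma> =
   of_nat (\<Prod>i\<in>UNIV. \<Prod>k<Poly_Mapping.lookup \<beta> i. Poly_Mapping.lookup (\<gamma> + \<beta>) i - k) * Poly_Mapping.lookup F (\<gamma> + \<beta>)"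
proof -
  let ?ff = "\<lambda>\<alpha>. (\<Prod>i\<in>UNIV. \<Prod>k<Poly_Mapping.lookup \<beta> i. Poly_Mapping.lookup \<alpha> i - k)"
  have "Poly_Mapping.lookup (pderivs \<beta> F) \<gamma> = (\<Sum>\<alpha>\<in>Poly_Mapping.keys F. if \<alpha> = \<gamma> + \<beta> then of_nat (?ff \<alpha>) * Poly_Mapping.lookup F \<alpha> else 0)"
    unfolding pderivs_def Poly_Mapping.lookup_sum
  proof (rule sum.cong[OF refl])
    fix \<alpha>
    show "Poly_Mapping.lookup (Poly_Mapping.single (\<alpha> - \<beta>) (of_nat (?ff \<alpha>) * Poly_Mapping.lookup F \<alpha>)) \<gamma> = (if \<alpha> = \<gamma> + \<beta> then of_nat (?ff \<alpha>) * Poly_Mapping.lookup F \<alpha> else 0)"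
    proof (cases "\<forall>i. Poly_Mapping.lookup \<beta> i \<le> Poly_Mapping.lookup \<alpha> i")
      case True
      then have "\<alpha> - \<beta> + \<beta> = \<alpha>" by (intro poly_mapping_eqI) (simp add: lookup_add lookup_minus)
      then show ?thesis by (auto simp: lookup_single when_def)
    next
      case False
      then have "\<alpha> \<noteq> \<gamma> + \<beta>" by (auto simp: lookup_add)
      then show ?thesis by (simp only: falling_factorials_eq_0[OF False]) simp
    qed
  qed
  also have "\<dots> = of_nat (?ff (\<gamma> + \<beta>)) * Poly_Mapping.lookup F (\<gamma> + \<beta>)"
    by (simp add: in_keys_iff)
  finally show ?thesis .
qed

lemma falling_factorial_add: "(\<Prod>k<a. (c + a) - k) * (\<Prod>k<b. (c + a + b) - k) = (\<Prod>k<a + b. (c + a + b) - (k::nat))" for a b c :: nat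
proof -
  have "(\<Prod>k<a + b. (c + a + b) - k) = (\<Prod>k=0..<b. (c + a + b) - k) * (\<Prod>k=b..<a+b. (c + a + b) - k)"
    by (subst prod.atLeastLessThan_concat) (auto simp: atLeast0LessThan)
  also have "(\<Prod>k=b..<a+b. (c + a + b) - k) = (\<Prod>k<a. (c + a) - k)"
    by (rule prod.reindex_bij_witness[of _ "\<lambda>k. k + b" "\<lambda>k. k - b"]) auto
  finally show ?thesis by (simp add: atLeast0LessThan mult.commute)
qed

lemma pderivs_pderivs: "pderivs \<beta> (pderivs \<gamma> F) = pderivs (\<beta> + \<gamma>) (F::'n::finite cpoly)"
proof (rule poly_mapping_eqI)
  fix \<delta>
  let ?l = Poly_Mapping.lookup
  have "(\<Prod>i\<in>UNIV. \<Prod>k<?l \<beta> i. ?l (\<delta> + \<beta>) i - k) * (\<Prod>i\<in>UNIV. \<Prod>k<?l \<gamma> i. ?l (\<delta> + \<beta> + \<gamma>) i - k)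
     = (\<Prod>i\<in>UNIV. \<Prod>k<?l (\<beta> + \<gamma>) i. ?l (\<delta> + (\<beta> + \<gamma>)) i - k)"
    unfolding prod.distrib[symmetric]
    by (rule prod.cong[OF refl]) (simp only: lookup_add falling_factorial_add add.assoc[symmetric] add.commute[of "?l \<gamma> _" "?l \<beta> _"])
  then show "?l (pderivs \<beta> (pderivs \<gamma> F)) \<delta> = ?l (pderivs (\<beta> + \<gamma>) F) \<delta>"
    by (simp only: lookup_pderivs add.assoc mult.assoc[symmetric] of_nat_mult[symmetric])
qed

abbreviation partial_deriv :: "'n::finite \<Rightarrow> 'n cpoly \<Rightarrow> 'n cpoly" where
  "partial_deriv i \<equiv> pderivs (Poly_Mapping.single i 1)"

definition diff_act :: "'n::finite cpoly \<Rightarrow> 'n cpoly \<Rightarrow> 'n cpoly" where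
  "diff_act h F = (\<Sum>\<beta>\<in>Poly_Mapping.keys h. pscale (Poly_Mapping.lookup h \<beta>) (pderivs \<beta> F))"

definition Ann :: "'n::finite cpoly \<Rightarrow> 'n cpoly set" where
  "Ann F = {h. diff_act h F = 0}"

definition concise :: "'n::finite cpoly \<Rightarrow> bool" where
  "concise F \<longleftrightarrow> Ann F \<inter> forms 1 \<subseteq> {0}"

definition Hess :: "'n::finite cpoly \<Rightarrow> 'n cpoly" where
  "Hess F = det (\<chi> i j. partial_deriv i (partial_deriv j F))"


subsection \<open>Border rank\<close>

text \<open>Affine cones are used for the Veronese variety and its secant varieties.\<close>

definition veronese :: "nat \<Rightarrow> 'n::finite cpoly set" where
  "veronese d = {linear_form v ^ d | v. v \<noteq> 0}"

definition secant_spans :: "nat \<Rightarrow> nat \<Rightarrow> 'n::finite cpoly set" where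
  "secant_spans r d =
     {\<Sum>i<r. pscale (c i) (P i) | c P. \<forall>i<r. P i \<in> veronese d}"

text \<open>
  The closure is taken in the product topology on coefficient functions, which on the
  finite-dimensional space of forms of degree \<open>d\<close> is the usual Euclidean topology.
\<close>

definition secant_variety :: "nat \<Rightarrow> nat \<Rightarrow> 'n::finite cpoly set" where
  "secant_variety r d = {F \<in> forms d. Poly_Mapping.lookup F \<in> closure (Poly_Mapping.lookup ` secant_spans r d)}"

definition border_rank :: "nat \<Rightarrow> 'n::finite cpoly \<Rightarrow> nat" where
  "border_rank d F = (LEAST r. F \<in> secant_variety r d)"


subsection \<open>Zero-dimensional schemes in projective space\<close>

text \<open>A closed subscheme of \<open>P\<^sup>n\<close> is given by its saturated homogeneous ideal in \<open>T\<close>.\<close>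

definition homogeneous_ideal :: "'n::finite cpoly set \<Rightarrow> bool" where
  "homogeneous_ideal J \<longleftrightarrow>
     0 \<in> J \<and> (\<forall>f\<in>J. \<forall>g\<in>J. f + g \<in> J) \<and> (\<forall>f\<in>J. \<forall>g. g * f \<in> J) \<and>
     (\<forall>f\<in>J. \<forall>m. hom_component m f \<in> J)"

definition saturated :: "'n::finite cpoly set \<Rightarrow> bool" where
  "saturated J \<longleftrightarrow> (\<forall>f. (\<exists>k. \<forall>g\<in>forms k. g * f \<in> J) \<longrightarrow> f \<in> J)"

definition hilbert_function :: "'n::finite cpoly set \<Rightarrow> nat \<Rightarrow> nat" where
  "hilbert_function J m =
     vector_space.dim pscale (forms m :: 'n cpoly set) - vector_space.dim pscale (J \<inter> forms m)"

text \<open>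
  \<open>J\<close> is the saturated ideal of a subscheme of length \<open>r\<close>, that is, one whose Hilbert polynomial is
  the constant \<open>r\<close>. For \<open>r = 0\<close> this is the empty scheme.
\<close>

definition zero_dim_scheme :: "nat \<Rightarrow> 'n::finite cpoly set \<Rightarrow> bool" where
  "zero_dim_scheme r J \<longleftrightarrow>
     homogeneous_ideal J \<and> saturated J \<and> (\<exists>m0. \<forall>m\<ge>m0. hilbert_function J m = r)"

text \<open>
  The linear span of the image in \<open>P(S\<^sup>d V*)\<close>, as an affine cone: the linear forms on \<open>S\<^sup>d V*\<close> are the
  maps \<open>G \<mapsto> h \<circ> G\<close> with \<open>h\<close> a form of degree \<open>d\<close> in \<open>T\<close>, and such a map restricts to \<open>d! h\<close> on
  \<open>P\<^sup>n\<close> via \<open>L \<mapsto> L\<^sup>d\<close>, so the hyperplanes containing the image are those with \<open>h \<in> J\<close>.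
\<close>

definition linear_span :: "nat \<Rightarrow> 'n::finite cpoly set \<Rightarrow> 'n cpoly set" where
  "linear_span d J = {G \<in> forms d. \<forall>h \<in> J \<inter> forms d. diff_act h G = 0}"

definition cactus_rank :: "nat \<Rightarrow> 'n::finite cpoly \<Rightarrow> nat" where
  "cactus_rank d F = (LEAST r. \<exists>J. zero_dim_scheme r J \<and> F \<in> linear_span d J)"


subsection \<open>Smoothable schemes\<close>

definition distinct_points :: "nat \<Rightarrow> (complex ^ 'n::finite) set \<Rightarrow> bool" where
  "distinct_points r Z \<longleftrightarrow> finite Z \<and> card Z = r \<and> 0 \<notin> Z \<and>
     (\<forall>v\<in>Z. \<forall>w\<in>Z. v \<noteq> w \<longrightarrow> (\<forall>c. v \<noteq> c *s w))"

text \<open>Polynomials vanishing on all lines spanned by elements of \<open>Z\<close>; this ideal is homogeneous.\<close>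

definition vanishing_ideal :: "(complex ^ 'n::finite) set \<Rightarrow> 'n cpoly set" where
  "vanishing_ideal Z = {h. \<forall>v\<in>Z. \<forall>c. peval h (c *s v) = 0}"

text \<open>
  \<open>J\<close> is the ideal of a flat limit of the schemes with ideals \<open>I 0, I 1, \<dots>\<close>: in all large degrees,
  \<open>J\<close> consists of the limits of elements of the \<open>I k\<close>. When all schemes involved have the same length
  (the flatness condition), this is convergence of the graded pieces in the Grassmannians of
  subspaces of \<open>T\<^sub>m\<close> for all large \<open>m\<close>, i.e. convergence in the Hilbert scheme.
\<close>

definition flat_limit :: "(nat \<Rightarrow> 'n::finite cpoly set) \<Rightarrow> 'n cpoly set \<Rightarrow> bool" where
  "flat_limit I J \<longleftrightarrow> (\<exists>m0. \<forall>m\<ge>m0. J \<inter> forms m =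
     {h. \<exists>g. (\<forall>k. g k \<in> I k \<inter> forms m) \<and> (\<forall>\<alpha>. (\<lambda>k. Poly_Mapping.lookup (g k) \<alpha>) \<longlonglongrightarrow> Poly_Mapping.lookup h \<alpha>)})"

definition smoothable_scheme :: "nat \<Rightarrow> 'n::finite cpoly set \<Rightarrow> bool" where
  "smoothable_scheme r J \<longleftrightarrow> zero_dim_scheme r J \<and>
     (\<exists>Z. (\<forall>k. distinct_points r (Z k)) \<and> flat_limit (\<lambda>k. vanishing_ideal (Z k)) J)"

definition smoothable_rank :: "nat \<Rightarrow> 'n::finite cpoly \<Rightarrow> nat" where
  "smoothable_rank d F = (LEAST r. \<exists>J. smoothable_scheme r J \<and> F \<in> linear_span d J)"

definition wild :: "nat \<Rightarrow> 'n::finite cpoly \<Rightarrow> bool" where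
  "wild d F \<longleftrightarrow> smoothable_rank d F > border_rank d F"

end

theory Submission
  imports Defs "HOL-Computational_Algebra.Primes"
begin

text \<open>
  If \<open>Hess F (v) \<noteq> 0\<close> and \<open>F\<close> is a limit of sums of \<open>dim V\<close> powers, then the powers come from points in general
  position off the hyperplane \<open>v = 0\<close>. The coordinate rings of these point sets, dehomogenised by \<open>v = 1\<close>, are
  multiplications on the fixed space \<open>complex ^ 'n\<close> with unit \<open>v\<close>, whose structure constants are third order data of
  \<open>F\<close> divided by the Hessian at \<open>v\<close>. They converge, so the point sets have a flat limit of length \<open>dim V\<close>, and this limit
  is apolar to \<open>F\<close>.

  Conversely, let \<open>J \<subseteq> Ann F\<close> define a scheme of length at most \<open>dim V\<close>, and let \<open>l\<close> be a linear form that is regular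
  modulo \<open>J\<close>. Since \<open>J\<close> contains no linear forms, \<open>T\<^sub>d\<^sub>-\<^sub>1 = l\<^sup>d\<^sup>-\<^sup>2 T\<^sub>1 + J\<^sub>d\<^sub>-\<^sub>1\<close>. Hence a linear form that annihilates
  the quadric \<open>l\<^sup>d\<^sup>-\<^sup>2 \<circ> F\<close> annihilates \<open>F\<close>, so that quadric, which is the Hessian of \<open>F\<close> at \<open>l\<close>, is nondegenerate.
\<close>

text \<open>Points tending to a scheme may collide, and then the coefficients of their powers can
  blow up, so neither can be controlled directly. What does converge are weighted moments, the
  pairings of the approximating forms with fixed forms of degree d. After padding by powers of the
  linear form of \<open>v\<close>, moments of order two give the Hessian matrix and moments of order
  three describe multiplication by a variable, which needs \<open>d \<ge> 3\<close>. Cramer's rule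
  with a nonzero limit determinant then takes the place of a compactness argument for the Hilbert
  scheme. The ranks are \<open>LEAST\<close> values, so a lower bound on them also requires that
  some admissible value exists; this is why powers of linear forms are shown to span all forms. The
  regular linear form is found by a dimension argument from saturation and the bound on the Hilbert
  function, in place of prime avoidance.\<close>

interpretation pv: vector_space pscale
  by (rule vector_space_pscale)

abbreviation coef :: "'a cpoly \<Rightarrow> ('a \<Rightarrow>\<^sub>0 nat) \<Rightarrow> complex" where
  "coef \<equiv> Poly_Mapping.lookup"

abbreviation expo :: "('a \<Rightarrow>\<^sub>0 nat) \<Rightarrow> 'a \<Rightarrow> nat" where
  "expo \<equiv> Poly_Mapping.lookup"

abbreviation monom :: "('a \<Rightarrow>\<^sub>0 nat) \<Rightarrow> 'a cpoly" where
  "monom \<alpha> \<equiv> Poly_Mapping.single \<alpha> 1"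

definition monom_val :: "('n::finite \<Rightarrow>\<^sub>0 nat) \<Rightarrow> complex ^ 'n \<Rightarrow> complex" where
  "monom_val \<alpha> v = (\<Prod>i\<in>UNIV. (v $ i) ^ expo \<alpha> i)"

text \<open>The multi-index factorial, which is the apolar pairing of a monomial with
  itself.\<close>

definition monom_fact :: "('n::finite \<Rightarrow>\<^sub>0 nat) \<Rightarrow> complex" where
  "monom_fact \<alpha> = (\<Prod>i\<in>UNIV. fact (expo \<alpha> i))"


section \<open>Polynomials\<close>

lemma coef_single_mult: "coef (Poly_Mapping.single \<beta> c * p) (\<beta> + \<gamma>) = c * coef p \<gamma>"
proof -
  have "coef (Poly_Mapping.single \<beta> c * p) (\<beta> + \<gamma>)
      = (\<Sum>l. (c when \<beta> = l) * (\<Sum>q. coef p q when \<beta> + \<gamma> = l + q))"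
    by (simp add: lookup_mult lookup_single)
  also have "\<dots> = c * (\<Sum>q. coef p q when \<beta> + \<gamma> = \<beta> + q)"
    by (simp add: when_mult)
  also have "\<dots> = c * coef p \<gamma>"
    by simp
  finally show ?thesis .
qed

lemma coef_single_mult_eq_0:
  assumes "\<And>\<gamma>. \<alpha> \<noteq> \<beta> + \<gamma>"
  shows "coef (Poly_Mapping.single \<beta> c * p) \<alpha> = 0"
proof (rule ccontr)
  assume "\<not> ?thesis"
  then have "\<alpha> \<in> Poly_Mapping.keys (Poly_Mapping.single \<beta> c * p)"
    by (simp add: in_keys_iff)
  with keys_mult[of "Poly_Mapping.single \<beta> c" p] assms show False
    by (auto split: if_splits)
qed

lemma coef_pscale [simp]: "coef (pscale c p) \<alpha> = c * coef p \<alpha>"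
  using coef_single_mult[of 0 c p \<alpha>] by (simp add: pscale_def)

lemma pscale_mult_left: "pscale c p * q = pscale c (p * q)"
  by (simp add: pscale_def mult.assoc)

lemma pscale_mult_right: "p * pscale c q = pscale c (p * q)"
  by (simp add: pscale_def mult.left_commute)

lemma pscale_power: "pscale c p ^ k = pscale (c ^ k) (p ^ k)"
  by (induction k) (simp_all add: pscale_mult_left pscale_mult_right)

lemma single_eq_pscale: "Poly_Mapping.single \<alpha> c = pscale c (monom \<alpha>)"
  by (simp add: pscale_def mult_single)

lemma monom_mult: "monom \<alpha> * monom \<beta> = monom (\<alpha> + \<beta>)"
  by (simp add: mult_single)

text \<open>The index set may exceed the support, so that all members of a sequence of forms can be
  expanded over one finite set and limits taken termwise.\<close>

lemma poly_eq_sum: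
  assumes "finite S" "Poly_Mapping.keys p \<subseteq> S"
  shows "p = (\<Sum>\<alpha>\<in>S. pscale (coef p \<alpha>) (monom \<alpha>))"
proof (rule poly_mapping_eqI)
  fix \<beta>
  have "coef (\<Sum>\<alpha>\<in>S. pscale (coef p \<alpha>) (monom \<alpha>)) \<beta>
      = (\<Sum>\<alpha>\<in>S. if \<beta> = \<alpha> then coef p \<alpha> else 0)"
    by (auto simp: lookup_sum lookup_single when_def intro!: sum.cong)
  also have "\<dots> = coef p \<beta>"
    using assms by (auto simp: in_keys_iff)
  finally show "coef p \<beta> = coef (\<Sum>\<alpha>\<in>S. pscale (coef p \<alpha>) (monom \<alpha>)) \<beta>" ..
qed

lemma poly_induct [case_names single add]:
  fixes p :: "'a cpoly"
  assumes single: "\<And>\<alpha> c. P (Poly_Mapping.single \<alpha> c)"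
    and add: "\<And>p q. P p \<Longrightarrow> P q \<Longrightarrow> P (p + q)"
  shows "P p"
proof -
  have "P (\<Sum>\<alpha>\<in>S. pscale (coef p \<alpha>) (monom \<alpha>))" if "finite S" for S
    using that
  proof induction
    case empty
    show ?case using single[of 0 0] by simp
  next
    case (insert \<alpha> S)
    then show ?case using add single by (simp add: single_eq_pscale[symmetric])
  qed
  from this[of "Poly_Mapping.keys p"] show ?thesis
    using poly_eq_sum[of "Poly_Mapping.keys p" p] by simp
qed

lemma expo_eq_add_single:
  assumes "expo \<alpha> i > 0"
  obtains \<beta> where "\<alpha> = Poly_Mapping.single i 1 + \<beta>"
proof
  show "\<alpha> = Poly_Mapping.single i 1 + (\<alpha> - Poly_Mapping.single i 1)"
    using assms by (intro poly_mapping_eqI) (auto simp: lookup_add lookup_minus lookup_single when_def)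
qed

lemma mdeg_add: "mdeg (\<alpha> + \<beta>) = mdeg \<alpha> + mdeg \<beta>"
  by (simp add: mdeg_def lookup_add sum.distrib)

lemma mdeg_single [simp]: "mdeg (Poly_Mapping.single i k) = k"
  by (simp add: mdeg_def lookup_single when_def)

lemma mdeg_zero [simp]: "mdeg 0 = 0"
  by (simp add: mdeg_def)

lemma mdeg_eq_0_iff [simp]: "mdeg \<alpha> = 0 \<longleftrightarrow> \<alpha> = 0"
  by (auto simp: mdeg_def intro!: poly_mapping_eqI)

lemma expo_le_mdeg: "expo \<alpha> i \<le> mdeg \<alpha>"
  unfolding mdeg_def by (rule member_le_sum) auto

lemma finite_mdeg_eq: "finite {\<alpha>::'n::finite \<Rightarrow>\<^sub>0 nat. mdeg \<alpha> = m}"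
proof -
  let ?A = "{\<alpha>::'n \<Rightarrow>\<^sub>0 nat. mdeg \<alpha> = m}"
  have "expo ` ?A \<subseteq> Pi\<^sub>E UNIV (\<lambda>i. {..m})"
  proof
    fix f assume "f \<in> expo ` ?A"
    then obtain \<alpha> :: "'n \<Rightarrow>\<^sub>0 nat" where "f = expo \<alpha>" "mdeg \<alpha> = m" by blast
    then show "f \<in> Pi\<^sub>E UNIV (\<lambda>i. {..m})"
      using expo_le_mdeg[of \<alpha>] by (simp add: PiE_UNIV_domain)
  qed
  moreover have "finite (Pi\<^sub>E (UNIV :: 'n set) (\<lambda>i. {..m}))"
    by (rule finite_PiE) simp_all
  ultimately have "finite (expo ` ?A)"
    by (rule finite_subset)
  moreover have "inj_on expo ?A"
    by (rule inj_onI) (metis poly_mapping_eq_iff)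
  ultimately show ?thesis
    by (rule finite_imageD)
qed

lemma mdeg_Suc_cases:
  assumes "mdeg \<alpha> = Suc k"
  obtains i \<beta> where "\<alpha> = Poly_Mapping.single i 1 + \<beta>" "mdeg \<beta> = k"
proof -
  have "\<alpha> \<noteq> 0" using assms by auto
  then obtain i where "expo \<alpha> i > 0"
    by (metis gr0I lookup_zero poly_mapping_eqI)
  then obtain \<beta> where "\<alpha> = Poly_Mapping.single i 1 + \<beta>"
    by (rule expo_eq_add_single)
  with assms that show ?thesis by (simp add: mdeg_add)
qed

text \<open>Limits of point sets are controlled only for multiplication by a single variable, hence
  this form of induction.\<close>

lemma poly_var_induct [case_names const var add]:
  fixes p :: "'n::finite cpoly"
  assumes const: "\<And>c. P (Poly_Mapping.single 0 c)"
    and var: "\<And>p i. P p \<Longrightarrow> P (var i * p)"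
    and add: "\<And>p q. P p \<Longrightarrow> P q \<Longrightarrow> P (p + q)"
  shows "P p"
proof (induction p rule: poly_induct)
  case (single \<alpha> c)
  show ?case
  proof (induction "mdeg \<alpha>" arbitrary: \<alpha>)
    case 0
    then show ?case using const[of c] by simp
  next
    case (Suc k)
    from Suc(2)[symmetric] obtain i \<beta> where "\<alpha> = Poly_Mapping.single i 1 + \<beta>" "mdeg \<beta> = k"
      by (rule mdeg_Suc_cases)
    with Suc(1)[of \<beta>] var[of "Poly_Mapping.single \<beta> c" i] show ?case
      by (simp add: var_def mult_single)
  qed
qed (rule add)


subsection \<open>Evaluation\<close>

lemma peval_eq_sum:
  assumes "finite S" "Poly_Mapping.keys p \<subseteq> S"
  shows "peval p v = (\<Sum>\<alpha>\<in>S. coef p \<alpha> * monom_val \<alpha> v)"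
  unfolding peval_def monom_val_def
  using assms by (intro sum.mono_neutral_left) (auto simp: in_keys_iff)

lemma peval_add [simp]: "peval (p + q) v = peval p v + peval q v"
proof -
  let ?S = "Poly_Mapping.keys p \<union> Poly_Mapping.keys q"
  have "peval f v = (\<Sum>\<alpha>\<in>?S. coef f \<alpha> * monom_val \<alpha> v)" if "f \<in> {p, q, p + q}" for f
    using that keys_add[of p q] by (intro peval_eq_sum) auto
  then show ?thesis
    by (simp add: lookup_add algebra_simps sum.distrib)
qed

lemma peval_single: "peval (Poly_Mapping.single \<alpha> c) v = c * monom_val \<alpha> v"
  by (subst peval_eq_sum[of "{\<alpha>}"]) auto

lemma monom_val_add: "monom_val (\<alpha> + \<beta>) v = monom_val \<alpha> v * monom_val \<beta> v"
  by (simp add: monom_val_def lookup_add power_add prod.distrib)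

lemma monom_val_zero [simp]: "monom_val 0 v = 1"
  by (simp add: monom_val_def)

lemma monom_val_single: "monom_val (Poly_Mapping.single i k) v = v $ i ^ k"
proof -
  have "monom_val (Poly_Mapping.single i k) v = (\<Prod>j\<in>UNIV. if j = i then v $ i ^ k else 1)"
    unfolding monom_val_def by (rule prod.cong) (auto simp: lookup_single when_def)
  then show ?thesis by simp
qed

lemma monom_val_cmul: "monom_val \<alpha> (c *s v) = c ^ mdeg \<alpha> * monom_val \<alpha> v"
  by (simp add: monom_val_def mdeg_def power_mult_distrib prod.distrib power_sum)

lemma peval_mult [simp]: "peval (p * q) v = peval p v * peval q v"
proof (induction p rule: poly_induct)
  case (single \<alpha> c)
  show ?case
    by (induction q rule: poly_induct)
      (simp_all add: mult_single peval_single monom_val_add algebra_simps)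
qed (simp_all add: algebra_simps)

lemma peval_zero [simp]: "peval 0 v = 0"
  by (simp add: peval_def)

lemma peval_one [simp]: "peval 1 v = 1"
  using peval_single[of 0 1 v] by simp

lemma peval_const [simp]: "peval (Poly_Mapping.single 0 c) v = c"
  by (simp add: peval_single)

lemma peval_pscale [simp]: "peval (pscale c p) v = c * peval p v"
  by (simp add: pscale_def)

lemma peval_minus [simp]: "peval (- p) v = - peval p v"
  using peval_add[of p "- p" v] by (simp add: eq_neg_iff_add_eq_0 add.commute)

lemma peval_diff [simp]: "peval (p - q) v = peval p v - peval q v"
  using peval_add[of p "- q" v] by simp

lemma peval_sum [simp]: "peval (sum f S) v = (\<Sum>x\<in>S. peval (f x) v)"
  by (induction S rule: infinite_finite_induct) auto

lemma peval_prod [simp]: "peval (prod f S) v = (\<Prod>x\<in>S. peval (f x) v)"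
  by (induction S rule: infinite_finite_induct) auto

lemma peval_power [simp]: "peval (p ^ k) v = peval p v ^ k"
  by (induction k) auto

lemma peval_of_int [simp]: "peval (of_int k) v = of_int k"
  using peval_const[of "of_int k" v] by simp

lemma peval_var [simp]: "peval (var i) v = v $ i"
  by (simp add: var_def peval_single monom_val_single)

lemma peval_linear_form: "peval (linear_form w) v = (\<Sum>i\<in>UNIV. w $ i * v $ i)"
  by (simp add: linear_form_def)

lemma peval_det: "peval (det A) v = det (\<chi> i j. peval (A $ i $ j) v)"
  by (simp add: det_def)


subsection \<open>Forms\<close>

lemma formsD: "F \<in> forms d \<Longrightarrow> mdeg \<alpha> \<noteq> d \<Longrightarrow> coef F \<alpha> = 0"
  by (auto simp: forms_def in_keys_iff)

lemma formsI: "(\<And>\<alpha>. mdeg \<alpha> \<noteq> d \<Longrightarrow> coef F \<alpha> = 0) \<Longrightarrow> F \<in> forms d"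
  by (auto simp: forms_def in_keys_iff)

lemma keys_forms: "F \<in> forms d \<Longrightarrow> Poly_Mapping.keys F \<subseteq> {\<alpha>. mdeg \<alpha> = d}"
  by (auto simp: forms_def)

lemma subspace_forms: "pv.subspace (forms d)"
  by (auto simp: pv.subspace_def lookup_add formsD intro!: formsI)

lemma forms_zero [simp]: "0 \<in> forms d"
  by (rule pv.subspace_0[OF subspace_forms])

lemma forms_add: "f \<in> forms d \<Longrightarrow> g \<in> forms d \<Longrightarrow> f + g \<in> forms d"
  by (rule pv.subspace_add[OF subspace_forms])

lemma forms_diff: "f \<in> forms d \<Longrightarrow> g \<in> forms d \<Longrightarrow> f - g \<in> forms d"
  by (rule pv.subspace_diff[OF subspace_forms])

lemma forms_pscale: "f \<in> forms d \<Longrightarrow> pscale c f \<in> forms d"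
  by (rule pv.subspace_scale[OF subspace_forms])

lemma forms_sum: "(\<And>x. x \<in> S \<Longrightarrow> f x \<in> forms d) \<Longrightarrow> sum f S \<in> forms d"
  by (rule pv.subspace_sum[OF subspace_forms])

lemma forms_single: "mdeg \<alpha> = d \<Longrightarrow> Poly_Mapping.single \<alpha> c \<in> forms d"
  by (auto simp: forms_def)

lemma forms_mult: "f \<in> forms a \<Longrightarrow> g \<in> forms b \<Longrightarrow> f * g \<in> forms (a + b)"
  using keys_mult[of f g] by (fastforce simp: forms_def mdeg_add)

lemma forms_one [simp]: "1 \<in> forms 0"
  using forms_single[of 0 0 1] by simp

lemma forms_power: "f \<in> forms a \<Longrightarrow> f ^ k \<in> forms (k * a)"
  by (induction k) (auto intro: forms_mult)

lemma forms_prod: "(\<And>x. x \<in> S \<Longrightarrow> f x \<in> forms (a x)) \<Longrightarrow> prod f S \<in> forms (sum a S)"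
  by (induction S rule: infinite_finite_induct) (auto intro: forms_mult)

lemma var_in_forms: "var i \<in> forms 1"
  by (simp add: var_def forms_single)

lemma linear_form_in_forms: "linear_form v \<in> forms 1"
  unfolding linear_form_def by (intro forms_sum forms_pscale var_in_forms)

lemma linear_form_power_in_forms: "linear_form v ^ k \<in> forms k"
  using forms_power[OF linear_form_in_forms, of v k] by simp

lemma linear_form_axis: "linear_form (axis i 1) = var i"
proof -
  have "linear_form (axis i 1) = (\<Sum>j\<in>UNIV. if j = i then var i else 0)"
    unfolding linear_form_def by (rule sum.cong) (auto simp: axis_def)
  then show ?thesis by simp
qed

lemma linear_form_add: "linear_form (v + w) = linear_form v + linear_form w"
  by (simp add: linear_form_def pv.scale_left_distrib sum.distrib)

lemma linear_form_cmul: "linear_form (c *s v) = pscale c (linear_form v)"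
  by (simp add: linear_form_def pv.scale_sum_right)

lemma coef_linear_form: "coef (linear_form v) (Poly_Mapping.single i 1) = v $ i"
proof -
  have inj: "Poly_Mapping.single j 1 = Poly_Mapping.single i (1::nat) \<longleftrightarrow> j = i" for i j :: 'a
    by (metis lookup_single_eq lookup_single_not_eq zero_neq_one)
  have "coef (linear_form v) (Poly_Mapping.single i 1) = (\<Sum>j\<in>UNIV. if j = i then v $ i else 0)"
    unfolding linear_form_def lookup_sum coef_pscale var_def lookup_single
    unfolding inj by (rule sum.cong) (auto simp: when_def)
  then show ?thesis by simp
qed

lemma linear_form_eq_0_iff [simp]: "linear_form v = 0 \<longleftrightarrow> v = 0"
proof
  assume "linear_form v = 0"
  then show "v = 0"
    using coef_linear_form[of v] by (simp add: vec_eq_iff)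
qed (simp add: linear_form_def)

lemma peval_form_cmul: "f \<in> forms m \<Longrightarrow> peval f (c *s v) = c ^ m * peval f v"
  by (auto simp: forms_def peval_eq_sum[OF finite_keys order_refl] monom_val_cmul sum_distrib_left
      intro!: sum.cong)

section \<open>Homogeneous components\<close>

lemma coef_hom_component: "coef (hom_component m h) \<alpha> = (if mdeg \<alpha> = m then coef h \<alpha> else 0)"
proof -
  have "coef (hom_component m h) \<alpha>
      = (\<Sum>\<beta>\<in>{\<beta>\<in>Poly_Mapping.keys h. mdeg \<beta> = m}. if \<beta> = \<alpha> then coef h \<alpha> else 0)"
    unfolding hom_component_def lookup_sum
    by (rule sum.cong) (auto simp: lookup_single when_def)
  then show ?thesis by (auto simp: in_keys_iff)
qed

lemma hom_component_in_forms: "hom_component m h \<in> forms m"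
  by (rule formsI) (simp add: coef_hom_component)

lemma hom_component_add: "hom_component m (f + g) = hom_component m f + hom_component m g"
  by (rule poly_mapping_eqI) (simp add: coef_hom_component lookup_add)

lemma hom_component_zero [simp]: "hom_component m 0 = 0"
  by (rule poly_mapping_eqI) (simp add: coef_hom_component)

lemma hom_component_form:
  "f \<in> forms k \<Longrightarrow> hom_component m f = (if m = k then f else 0)"
  by (rule poly_mapping_eqI) (auto simp: coef_hom_component formsD)

lemma hom_component_form_mult:
  assumes "f \<in> forms k"
  shows "hom_component m (f * g) = (if k \<le> m then f * hom_component (m - k) g else 0)"
proof (induction g rule: poly_induct)
  case (single \<alpha> c)
  have *: "Poly_Mapping.single \<alpha> c \<in> forms (mdeg \<alpha>)"
    by (simp add: forms_single)
  show ?case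
    using assms by (auto simp: hom_component_form[OF forms_mult[OF assms *]] hom_component_form[OF *])
qed (simp_all add: hom_component_add distrib_left)

lemma sum_hom_component:
  "f = (\<Sum>m\<in>mdeg ` Poly_Mapping.keys f. hom_component m f)"
proof (rule poly_mapping_eqI)
  fix \<alpha>
  show "coef f \<alpha> = coef (\<Sum>m\<in>mdeg ` Poly_Mapping.keys f. hom_component m f) \<alpha>"
    by (auto simp: lookup_sum coef_hom_component in_keys_iff)
qed


subsection \<open>The apolar pairing\<close>

text \<open>The constant term of the derivative. On forms of equal degree this is the classical
  apolar bilinear form: symmetric, with orthogonal monomials.\<close>

definition apair :: "'n::finite cpoly \<Rightarrow> 'n cpoly \<Rightarrow> complex" where
  "apair h F = coef (diff_act h F) 0"

lemma fact_eq_prod_lessThan: "(\<Prod>k<n. n - k) = (fact n :: nat)"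
  by (simp add: fact_prod_rev atLeast0LessThan)

lemma apair_eq_sum_keys: "apair h F = (\<Sum>\<beta>\<in>Poly_Mapping.keys h. coef h \<beta> * (monom_fact \<beta> * coef F \<beta>))"
  by (simp add: apair_def diff_act_def lookup_sum lookup_pderivs fact_eq_prod_lessThan monom_fact_def)

lemma apair_eq_sum:
  assumes "finite S" "Poly_Mapping.keys h \<subseteq> S"
  shows "apair h F = (\<Sum>\<beta>\<in>S. coef h \<beta> * (monom_fact \<beta> * coef F \<beta>))"
  unfolding apair_eq_sum_keys
  using assms by (intro sum.mono_neutral_left) (auto simp: in_keys_iff)

lemma apair_commute: "apair h F = apair F h"
  using apair_eq_sum[of "Poly_Mapping.keys h \<union> Poly_Mapping.keys F" h F]
    apair_eq_sum[of "Poly_Mapping.keys h \<union> Poly_Mapping.keys F" F h]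
  by (simp add: ac_simps)

lemma apair_add_right: "apair h (F + G) = apair h F + apair h G"
  by (simp add: apair_eq_sum_keys lookup_add algebra_simps sum.distrib)

lemma apair_pscale_right: "apair h (pscale c F) = c * apair h F"
  by (simp add: apair_eq_sum_keys sum_distrib_left ac_simps)

lemma apair_add_left: "apair (g + h) F = apair g F + apair h F"
  using apair_add_right[of F g h] by (simp add: apair_commute)

lemma apair_pscale_left: "apair (pscale c h) F = c * apair h F"
  using apair_pscale_right[of F c h] by (simp add: apair_commute)

lemma apair_zero_left [simp]: "apair 0 F = 0"
  by (simp add: apair_eq_sum_keys)

lemma apair_zero_right [simp]: "apair h 0 = 0"
  by (simp add: apair_eq_sum_keys)

lemma apair_sum_left: "apair (sum f S) F = (\<Sum>x\<in>S. apair (f x) F)"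
  by (induction S rule: infinite_finite_induct) (auto simp: apair_add_left)

lemma apair_sum_right: "apair h (sum f S) = (\<Sum>x\<in>S. apair h (f x))"
  by (induction S rule: infinite_finite_induct) (auto simp: apair_add_right)

lemma monom_fact_nonzero [simp]: "monom_fact \<alpha> \<noteq> 0"
  by (simp add: monom_fact_def)

lemma apair_monom: "apair (monom \<beta>) F = monom_fact \<beta> * coef F \<beta>"
  by (simp add: apair_eq_sum_keys)

lemma diff_act_eq_sum:
  assumes "finite S" "Poly_Mapping.keys h \<subseteq> S"
  shows "diff_act h F = (\<Sum>\<beta>\<in>S. pscale (coef h \<beta>) (pderivs \<beta> F))"
  unfolding diff_act_def
  using assms by (intro sum.mono_neutral_left) (auto simp: in_keys_iff)

lemma diff_act_add_left: "diff_act (g + h) F = diff_act g F + diff_act h F"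
proof -
  let ?S = "Poly_Mapping.keys g \<union> Poly_Mapping.keys h"
  have "diff_act f F = (\<Sum>\<beta>\<in>?S. pscale (coef f \<beta>) (pderivs \<beta> F))" if "f \<in> {g, h, g + h}" for f
    using that keys_add[of g h] by (intro diff_act_eq_sum) auto
  then show ?thesis
    by (simp add: lookup_add pv.scale_left_distrib sum.distrib)
qed

lemma diff_act_single: "diff_act (Poly_Mapping.single \<beta> c) F = pscale c (pderivs \<beta> F)"
  by (subst diff_act_eq_sum[of "{\<beta>}"]) auto

lemma pderivs_add: "pderivs \<beta> (F + G) = pderivs \<beta> F + pderivs \<beta> G"
  by (rule poly_mapping_eqI) (simp add: lookup_pderivs lookup_add algebra_simps)

lemma pderivs_pscale: "pderivs \<beta> (pscale c F) = pscale c (pderivs \<beta> F)"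
  by (rule poly_mapping_eqI) (simp add: lookup_pderivs)

lemma diff_act_add_right: "diff_act h (F + G) = diff_act h F + diff_act h G"
  by (simp add: diff_act_def pderivs_add pv.scale_right_distrib sum.distrib)

lemma diff_act_mult: "diff_act (g * h) F = diff_act g (diff_act h F)"
proof (induction g rule: poly_induct)
  case (single \<alpha> c)
  show ?case
    by (induction h rule: poly_induct)
      (simp_all add: mult_single diff_act_single pderivs_pscale pderivs_pderivs distrib_left
        diff_act_add_left diff_act_add_right)
qed (simp_all add: distrib_right diff_act_add_left)

lemma apair_mult: "apair (g * h) F = apair g (diff_act h F)"
  by (simp add: apair_def diff_act_mult)

text \<open>Pairing \<open>F\<close> with \<open>monom \<gamma> * h\<close> gives the coefficient at
  \<gamma> of the derivative of \<open>F\<close> by \<open>h\<close>, up to a nonzero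
  factorial.\<close>

lemma diff_act_eq_0_iff: "diff_act h F = 0 \<longleftrightarrow> (\<forall>\<gamma>. apair (monom \<gamma> * h) F = 0)"
  by (auto simp: apair_mult apair_monom intro: poly_mapping_eqI)

lemma apair_forms_eq_0:
  assumes "h \<in> forms a" "F \<in> forms b" "a \<noteq> b"
  shows "apair h F = 0"
  unfolding apair_eq_sum_keys
  using assms by (intro sum.neutral) (auto simp: forms_def in_keys_iff)

lemma diff_act_form_eq_0_iff:
  assumes "h \<in> forms a" "F \<in> forms (a + b)"
  shows "diff_act h F = 0 \<longleftrightarrow> (\<forall>\<gamma>. mdeg \<gamma> = b \<longrightarrow> apair (monom \<gamma> * h) F = 0)"
proof -
  have "apair (monom \<gamma> * h) F = 0" if "mdeg \<gamma> \<noteq> b" for \<gamma>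
    using that assms forms_mult[OF forms_single[OF refl] assms(1)]
    by (intro apair_forms_eq_0[of _ "mdeg \<gamma> + a" _ "a + b"]) auto
  then show ?thesis by (auto simp: diff_act_eq_0_iff)
qed

lemma diff_act_same_degree_eq_0_iff:
  assumes "h \<in> forms d" "F \<in> forms d"
  shows "diff_act h F = 0 \<longleftrightarrow> apair h F = 0"
  using diff_act_form_eq_0_iff[of h d F 0] assms by auto

section \<open>Powers of linear forms as evaluation functionals\<close>

lemma coef_linear_form_mult:
  "coef (linear_form u * p) \<alpha>
    = (\<Sum>i | expo \<alpha> i > 0. u $ i * coef p (\<alpha> - Poly_Mapping.single i 1))"
proof -
  have "coef (linear_form u * p) \<alpha> = (\<Sum>i\<in>UNIV. u $ i * coef (var i * p) \<alpha>)"
    by (simp add: linear_form_def sum_distrib_right lookup_sum pscale_mult_left)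
  \<comment> \<open>Indices with exponent 0 must be removed before \<alpha> is lowered, because
    subtraction of exponents is truncated.\<close>
  also have "\<dots> = (\<Sum>i | expo \<alpha> i > 0. u $ i * coef (var i * p) \<alpha>)"
  proof (rule sum.mono_neutral_right)
    show "\<forall>i\<in>UNIV - {i. expo \<alpha> i > 0}. u $ i * coef (var i * p) \<alpha> = 0"
      by (auto simp: var_def lookup_add intro!: coef_single_mult_eq_0)
  qed auto
  also have "\<dots> = (\<Sum>i | expo \<alpha> i > 0. u $ i * coef p (\<alpha> - Poly_Mapping.single i 1))"
  proof (rule sum.cong[OF refl])
    fix i assume "i \<in> {i. expo \<alpha> i > 0}"
    then obtain \<beta> where \<beta>: "\<alpha> = Poly_Mapping.single i 1 + \<beta>"
      by (auto elim: expo_eq_add_single)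
    show "u $ i * coef (var i * p) \<alpha> = u $ i * coef p (\<alpha> - Poly_Mapping.single i 1)"
      unfolding \<beta> var_def coef_single_mult by simp
  qed
  finally show ?thesis .
qed

lemma monom_fact_single_add:
  "monom_fact (Poly_Mapping.single i 1 + \<beta>) = of_nat (Suc (expo \<beta> i)) * monom_fact \<beta>"
proof -
  have "monom_fact (Poly_Mapping.single i 1 + \<beta>)
      = (\<Prod>j\<in>UNIV. (if j = i then of_nat (Suc (expo \<beta> i)) else 1) * fact (expo \<beta> j))"
    unfolding monom_fact_def by (rule prod.cong) (auto simp: lookup_add lookup_single when_def)
  then show ?thesis by (simp add: prod.distrib monom_fact_def)
qed

text \<open>The multinomial theorem with denominators cleared. In the induction step each variable
  contributes its exponent in \<alpha>, and the exponents add up to the degree.\<close>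

lemma coef_linear_form_power:
  "mdeg \<alpha> = d \<Longrightarrow> monom_fact \<alpha> * coef (linear_form u ^ d) \<alpha> = fact d * monom_val \<alpha> u"
proof (induction d arbitrary: \<alpha>)
  case 0
  then show ?case by (simp add: monom_fact_def lookup_one)
next
  case (Suc d)
  have "monom_fact \<alpha> * coef (linear_form u ^ Suc d) \<alpha>
      = (\<Sum>i | expo \<alpha> i > 0. monom_fact \<alpha> *
          (u $ i * coef (linear_form u ^ d) (\<alpha> - Poly_Mapping.single i 1)))"
    by (simp add: coef_linear_form_mult sum_distrib_left)
  also have "\<dots> = (\<Sum>i | expo \<alpha> i > 0. of_nat (expo \<alpha> i) * (fact d * monom_val \<alpha> u))"
  proof (rule sum.cong[OF refl])
    fix i assume "i \<in> {i. expo \<alpha> i > 0}"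
    then obtain \<beta> where \<beta>: "\<alpha> = Poly_Mapping.single i 1 + \<beta>"
      by (auto elim: expo_eq_add_single)
    with Suc.prems have d: "mdeg \<beta> = d" by (simp add: mdeg_add)
    have "monom_fact \<alpha> * (u $ i * coef (linear_form u ^ d) (\<alpha> - Poly_Mapping.single i 1))
        = of_nat (Suc (expo \<beta> i)) * u $ i * (monom_fact \<beta> * coef (linear_form u ^ d) \<beta>)"
      unfolding \<beta> monom_fact_single_add by simp
    also have "\<dots> = of_nat (expo \<alpha> i) * (fact d * monom_val \<alpha> u)"
      unfolding Suc.IH[OF d] \<beta> by (simp add: lookup_add monom_val_add monom_val_single)
    finally show "monom_fact \<alpha> * (u $ i * coef (linear_form u ^ d) (\<alpha> - Poly_Mapping.single i 1))
        = of_nat (expo \<alpha> i) * (fact d * monom_val \<alpha> u)" .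
  qed
  also have "\<dots> = (\<Sum>i\<in>UNIV. of_nat (expo \<alpha> i) * (fact d * monom_val \<alpha> u))"
    by (rule sum.mono_neutral_left) auto
  also have "\<dots> = of_nat (mdeg \<alpha>) * (fact d * monom_val \<alpha> u)"
    by (simp add: mdeg_def sum_distrib_right)
  finally show ?case using Suc.prems by simp
qed

text \<open>The reproducing property: pairing with a d-th power is evaluation at the corresponding
  point. It translates between sums of powers and finite point sets.\<close>

lemma apair_linear_form_power:
  assumes "h \<in> forms d"
  shows "apair h (linear_form u ^ d) = fact d * peval h u"
proof -
  have "apair h (linear_form u ^ d)
      = (\<Sum>\<beta>\<in>Poly_Mapping.keys h. coef h \<beta> * (fact d * monom_val \<beta> u))"
    unfolding apair_eq_sum_keys
    using assms by (intro sum.cong) (auto simp: forms_def coef_linear_form_power)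
  then show ?thesis
    by (simp add: peval_def monom_val_def sum_distrib_left ac_simps)
qed

lemma pderivs_in_forms:
  fixes F :: "'n::finite cpoly"
  assumes "F \<in> forms (d + mdeg \<beta>)"
  shows "pderivs \<beta> F \<in> forms d"
proof (rule formsI)
  fix \<alpha> :: "'n \<Rightarrow>\<^sub>0 nat"
  assume "mdeg \<alpha> \<noteq> d"
  then show "coef (pderivs \<beta> F) \<alpha> = 0"
    using formsD[OF assms, of "\<alpha> + \<beta>"] by (simp add: lookup_pderivs mdeg_add)
qed

section \<open>The Hessian matrix at a point as a pairing\<close>

definition hessian_at :: "'n::finite cpoly \<Rightarrow> complex ^ 'n \<Rightarrow> complex ^ 'n ^ 'n" where
  "hessian_at F v = (\<chi> i j. peval (partial_deriv i (partial_deriv j F)) v)"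

lemma peval_Hess: "peval (Hess F) v = det (hessian_at F v)"
  by (simp add: Hess_def hessian_at_def peval_det)

text \<open>The second partials are forms of degree m, and pairing with
  \<open>linear_form v ^ m\<close> evaluates them at \<open>v\<close>. The Hessian matrix is thus,
  up to \<open>fact m\<close>, the matrix of the quadric obtained from \<open>F\<close> by
  differentiating m times along \<open>v\<close>.\<close>

lemma apair_var_var_power:
  assumes "F \<in> forms (Suc (Suc m))"
  shows "apair (var i * var j * linear_form v ^ m) F = fact m * hessian_at F v $ i $ j"
proof -
  have "partial_deriv j F \<in> forms (Suc m)"
    by (rule pderivs_in_forms) (use assms in simp)
  then have "partial_deriv i (partial_deriv j F) \<in> forms m"
    by (intro pderivs_in_forms[of _ m "Poly_Mapping.single i 1"]) simp
  from apair_linear_form_power[OF this, of v]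
  have "fact m * hessian_at F v $ i $ j
      = apair (linear_form v ^ m) (diff_act (var i) (diff_act (var j) F))"
    by (simp add: hessian_at_def var_def diff_act_single apair_commute)
  then show ?thesis
    by (simp add: apair_mult[symmetric] diff_act_mult[symmetric] ac_simps)
qed


section \<open>Interpolation\<close>

text \<open>
  For pairwise distinct primes \<open>p\<^sub>i\<close> the points \<open>(p\<^sub>i\<^sup>t)\<^sub>i\<close>, \<open>t = 0, 1, \<dots>\<close>, turn distinct monomials into
  geometric progressions with distinct ratios, by unique factorization. Monomials are then separated by Lagrange
  interpolation in one variable.
\<close>

lemma exists_prime_nodes:
  "\<exists>(g :: 'n::finite \<Rightarrow> nat). (\<forall>i. g i > 0) \<and> inj (\<lambda>\<beta>. \<Prod>i\<in>UNIV. g i ^ expo \<beta> i)"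
proof -
  obtain P :: "nat set" where P: "P \<subseteq> {p. prime p}" "card P = CARD('n)" "finite P"
    using infinite_arbitrarily_large[OF primes_infinite] by blast
  then obtain g :: "'n \<Rightarrow> nat" where g: "bij_betw g UNIV P"
    by (metis finite_class.finite_UNIV finite_same_card_bij)
  have prime: "prime (g i)" for i
    using P(1) bij_betwE[OF g] by blast
  have mult: "multiplicity (g j) (\<Prod>i\<in>UNIV. g i ^ expo \<beta> i) = expo \<beta> j" for \<beta> j
  proof -
    have "(\<Prod>i\<in>UNIV. g i ^ expo \<beta> i) = (\<Prod>i\<in>UNIV. (\<lambda>p. p ^ expo \<beta> (inv g p)) (g i))"
      using g by (simp add: bij_betw_def inv_f_f)
    also have "\<dots> = (\<Prod>p\<in>P. p ^ expo \<beta> (inv g p))"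
      using g by (rule prod.reindex_bij_betw)
    also have "multiplicity (g j) \<dots> = expo \<beta> j"
      using P prime[of j] g bij_betwE[OF g]
      by (subst multiplicity_prod_prime_powers) (auto simp: bij_betw_def inv_f_f)
    finally show ?thesis .
  qed
  have "inj (\<lambda>\<beta>. \<Prod>i\<in>UNIV. g i ^ expo \<beta> i)"
  proof (rule injI)
    fix \<beta> \<gamma> :: "'n \<Rightarrow>\<^sub>0 nat"
    assume "(\<Prod>i\<in>UNIV. g i ^ expo \<beta> i) = (\<Prod>i\<in>UNIV. g i ^ expo \<gamma> i)"
    then show "\<beta> = \<gamma>" by (intro poly_mapping_eqI) (metis mult)
  qed
  with prime show ?thesis by (blast intro: prime_gt_0_nat)
qed

lemma exists_separating_points:
  obtains v :: "nat \<Rightarrow> complex ^ 'n::finite"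
  where "\<And>t. v t \<noteq> 0"
    and "\<And>E \<alpha>. finite E \<Longrightarrow>
      \<exists>K c. \<forall>\<beta>\<in>E. (\<Sum>t<K. c t * monom_val \<beta> (v t)) = (if \<beta> = \<alpha> then 1 else 0)"
proof -
  obtain g :: "'n \<Rightarrow> nat" where g: "\<And>i. g i > 0" "inj (\<lambda>\<beta>. \<Prod>i\<in>UNIV. g i ^ expo \<beta> i)"
    using exists_prime_nodes by blast
  define q :: "('n \<Rightarrow>\<^sub>0 nat) \<Rightarrow> complex" where "q \<beta> = of_nat (\<Prod>i\<in>UNIV. g i ^ expo \<beta> i)" for \<beta>
  have q_inj: "q \<beta> = q \<gamma> \<longleftrightarrow> \<beta> = \<gamma>" for \<beta> \<gamma>
    unfolding q_def of_nat_eq_iff using inj_eq[OF g(2)] .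
  define v :: "nat \<Rightarrow> complex ^ 'n" where "v t = (\<chi> i. of_nat (g i) ^ t)" for t
  have val: "monom_val \<beta> (v t) = q \<beta> ^ t" for \<beta> t
    by (simp add: monom_val_def v_def q_def prod_power_distrib power_mult[symmetric] mult.commute)
  show thesis
  proof
    show "v t \<noteq> 0" for t
      using g(1) by (auto simp: v_def vec_eq_iff intro!: exI)
  next
    fix E :: "('n \<Rightarrow>\<^sub>0 nat) set" and \<alpha> assume E: "finite E"
    \<comment> \<open>The Lagrange polynomial with value 1 at \<open>q \<alpha>\<close> and 0 at the
      other nodes. Since \<open>monom_val \<beta> (v t)\<close> is \<open>q \<beta> ^ t\<close>, its
      coefficients are the wanted weights \<open>c t\<close>.\<close>
    define P where "P = (\<Prod>\<gamma>\<in>E - {\<alpha>}. Polynomial.smult (1 / (q \<alpha> - q \<gamma>)) [:- q \<gamma>, 1:])"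
    have P: "poly P (q \<beta>) = (if \<beta> = \<alpha> then 1 else 0)" if "\<beta> \<in> E" for \<beta>
    proof (cases "\<beta> = \<alpha>")
      case True
      have "poly P (q \<alpha>) = (\<Prod>\<gamma>\<in>E - {\<alpha>}. 1)"
        unfolding P_def poly_prod by (rule prod.cong) (auto simp: q_inj field_simps)
      then show ?thesis using True by simp
    next
      case False
      then show ?thesis
        using E that by (auto simp: P_def poly_prod intro!: prod_zero bexI[of _ \<beta>])
    qed
    show "\<exists>K c. \<forall>\<beta>\<in>E. (\<Sum>t<K. c t * monom_val \<beta> (v t)) = (if \<beta> = \<alpha> then 1 else 0)"
      by (rule exI[of _ "Suc (degree P)"], rule exI[of _ "Polynomial.coeff P"])
        (simp add: val P[symmetric] poly_altdef lessThan_Suc_atMost)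
  qed
qed

text \<open>A combination of evaluations isolates any single coefficient, so a polynomial that
  vanishes at every point has no nonzero coefficient.\<close>

lemma exists_peval_nonzero:
  assumes "p \<noteq> 0"
  shows "\<exists>v. peval p v \<noteq> 0"
proof (rule ccontr)
  assume zero: "\<not> ?thesis"
  obtain \<alpha> where \<alpha>: "coef p \<alpha> \<noteq> 0"
    using assms by (metis lookup_zero poly_mapping_eqI)
  obtain v :: "nat \<Rightarrow> complex ^ 'a" where "\<And>E \<alpha>. finite E \<Longrightarrow>
      \<exists>K c. \<forall>\<beta>\<in>E. (\<Sum>t<K. c t * monom_val \<beta> (v t)) = (if \<beta> = \<alpha> then 1 else 0)"
    by (rule exists_separating_points) blast
  from this[of "Poly_Mapping.keys p" \<alpha>] obtain K c where
    c: "\<And>\<beta>. \<beta> \<in> Poly_Mapping.keys p \<Longrightarrow>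
      (\<Sum>t<K. c t * monom_val \<beta> (v t)) = (if \<beta> = \<alpha> then 1 else 0)"
    by auto
  have "0 = (\<Sum>t<K. c t * peval p (v t))"
    using zero by simp
  also have "\<dots> = (\<Sum>\<beta>\<in>Poly_Mapping.keys p. coef p \<beta> * (\<Sum>t<K. c t * monom_val \<beta> (v t)))"
    by (simp add: peval_eq_sum[OF finite_keys order_refl] sum_distrib_left ac_simps,
        subst sum.swap, simp)
  also have "\<dots> = (\<Sum>\<beta>\<in>Poly_Mapping.keys p. if \<beta> = \<alpha> then coef p \<alpha> else 0)"
    by (rule sum.cong) (auto simp: c)
  also have "\<dots> = coef p \<alpha>"
    using \<alpha> by (simp add: in_keys_iff)
  finally show False using \<alpha> by simp
qed

text \<open>By the multinomial formula, a combination of evaluations that isolates a monomial turns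
  into a combination of d-th powers that equals the monomial. Only finitely many monomials have
  degree d, so one finite point set serves them all.\<close>

lemma exists_powers_spanning:
  obtains Z :: "(complex ^ 'n::finite) set"
  where "finite Z" "0 \<notin> Z" "\<And>\<alpha>. mdeg \<alpha> = d \<Longrightarrow> \<exists>c. monom \<alpha> = (\<Sum>v\<in>Z. pscale (c v) (linear_form v ^ d))"
proof -
  obtain v :: "nat \<Rightarrow> complex ^ 'n" where v: "\<And>t. v t \<noteq> 0"
    "\<And>E \<alpha>. finite E \<Longrightarrow>
      \<exists>K c. \<forall>\<beta>\<in>E. (\<Sum>t<K. c t * monom_val \<beta> (v t)) = (if \<beta> = \<alpha> then 1 else 0)"
    by (rule exists_separating_points) blast
  let ?E = "{\<alpha>::'n \<Rightarrow>\<^sub>0 nat. mdeg \<alpha> = d}"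
  obtain K c where c: "\<And>\<alpha> \<beta>. \<beta> \<in> ?E \<Longrightarrow>
      (\<Sum>t<K \<alpha>. c \<alpha> t * monom_val \<beta> (v t)) = (if \<beta> = \<alpha> then 1 else 0)"
    using v(2)[OF finite_mdeg_eq] by metis
  let ?N = "Max (K ` ?E)"
  have K: "K \<alpha> \<le> ?N" if "\<alpha> \<in> ?E" for \<alpha>
    using that by (intro Max_ge) (auto simp: finite_mdeg_eq)
  show thesis
  proof
    show "finite (v ` {..<?N})" "0 \<notin> v ` {..<?N}"
      using v(1) by (auto simp: eq_commute[of 0])
    fix \<alpha> :: "'n \<Rightarrow>\<^sub>0 nat" assume \<alpha>: "mdeg \<alpha> = d"
    let ?c = "\<lambda>t. c \<alpha> t * monom_fact \<alpha> / fact d"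
    have "monom \<alpha> = (\<Sum>t<K \<alpha>. pscale (?c t) (linear_form (v t) ^ d))"
    proof (rule poly_mapping_eqI)
      fix \<beta>
      show "coef (monom \<alpha>) \<beta> = coef (\<Sum>t<K \<alpha>. pscale (?c t) (linear_form (v t) ^ d)) \<beta>"
      proof (cases "mdeg \<beta> = d")
        case True
        have "coef (linear_form u ^ d) \<beta> = fact d * monom_val \<beta> u / monom_fact \<beta>" for u
          using coef_linear_form_power[OF True, of u] by (simp add: field_simps)
        then have "coef (\<Sum>t<K \<alpha>. pscale (?c t) (linear_form (v t) ^ d)) \<beta>
            = (\<Sum>t<K \<alpha>. c \<alpha> t * monom_val \<beta> (v t)) * (monom_fact \<alpha> / monom_fact \<beta>)"
          unfolding lookup_sum sum_distrib_right by (intro sum.cong) simp_all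
        also have "\<dots> = coef (monom \<alpha>) \<beta>"
          using c[of \<beta> \<alpha>] True by (auto simp: lookup_single when_def)
        finally show ?thesis ..
      next
        case False
        then show ?thesis
          using \<alpha> formsD[OF linear_form_power_in_forms False]
          by (auto simp: lookup_sum lookup_single when_def)
      qed
    qed
    \<comment> \<open>Padding with zero coefficients brings all monomials to the common range of
      points.\<close>
    also have "\<dots> = (\<Sum>t<?N. pscale (if t < K \<alpha> then ?c t else 0) (linear_form (v t) ^ d))"
      using K[of \<alpha>] \<alpha> by (intro sum.mono_neutral_cong_left) auto
    \<comment> \<open>\<open>Z\<close> is a set of points, so coefficients belonging to the same
      point are added up.\<close>
    also have "\<dots> = (\<Sum>w\<in>v ` {..<?N}. \<Sum>t\<in>{t\<in>{..<?N}. v t = w}.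
        pscale (if t < K \<alpha> then ?c t else 0) (linear_form (v t) ^ d))"
      by (rule sum.image_gen) simp
    also have "\<dots> = (\<Sum>w\<in>v ` {..<?N}. pscale (\<Sum>t\<in>{t\<in>{..<?N}. v t = w}. if t < K \<alpha> then ?c t else 0)
        (linear_form w ^ d))"
      by (rule sum.cong) (auto simp: pv.scale_sum_left)
    finally show "\<exists>c. monom \<alpha> = (\<Sum>w\<in>v ` {..<?N}. pscale (c w) (linear_form w ^ d))"
      by (rule exI[of _ "\<lambda>w. \<Sum>t\<in>{t\<in>{..<?N}. v t = w}. if t < K \<alpha> then ?c t else 0"])
  qed
qed

text \<open>Dual to the spanning statement: a form vanishing on \<open>Z\<close> pairs to zero with
  the powers that span all monomials of degree d.\<close>

lemma exists_points_determining_forms: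
  obtains Z :: "(complex ^ 'n::finite) set"
  where "finite Z" "0 \<notin> Z" "\<And>f. f \<in> forms d \<Longrightarrow> (\<And>v. v \<in> Z \<Longrightarrow> peval f v = 0) \<Longrightarrow> f = 0"
proof -
  obtain Z :: "(complex ^ 'n) set" where Z: "finite Z" "0 \<notin> Z"
    "\<And>\<alpha>. mdeg \<alpha> = d \<Longrightarrow> \<exists>c. monom \<alpha> = (\<Sum>v\<in>Z. pscale (c v) (linear_form v ^ d))"
    by (rule exists_powers_spanning[of d]) blast
  show thesis
  proof
    fix f :: "'n cpoly" assume f: "f \<in> forms d" "\<And>v. v \<in> Z \<Longrightarrow> peval f v = 0"
    show "f = 0"
    proof (rule poly_mapping_eqI)
      fix \<alpha>
      show "coef f \<alpha> = coef 0 \<alpha>"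
      proof (cases "mdeg \<alpha> = d")
        case True
        then obtain c where "monom \<alpha> = (\<Sum>v\<in>Z. pscale (c v) (linear_form v ^ d))"
          using Z(3) by blast
        then have "apair f (monom \<alpha>) = (\<Sum>v\<in>Z. c v * (fact d * peval f v))"
          using f(1) by (simp add: apair_sum_right apair_pscale_right apair_linear_form_power)
        then have "apair (monom \<alpha>) f = 0"
          using f(2) by (simp add: apair_commute)
        then show ?thesis by (simp add: apair_monom)
      qed (simp add: formsD[OF f(1)])
    qed
  qed (use Z in auto)
qed


section \<open>Secant varieties\<close>

lemma secant_spans_subset_forms: "secant_spans r d \<subseteq> forms d"
  unfolding secant_spans_def veronese_def
  by (auto intro!: forms_sum forms_pscale) (metis linear_form_power_in_forms)

lemma secant_spans_sum_powers:
  assumes "finite Z" "0 \<notin> Z"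
  shows "(\<Sum>v\<in>Z. pscale (c v) (linear_form v ^ d)) \<in> secant_spans (card Z) d"
proof -
  obtain h where h: "bij_betw h {..<card Z} Z"
    using ex_bij_betw_nat_finite[OF assms(1)] by (auto simp: atLeast0LessThan)
  have "(\<Sum>v\<in>Z. pscale (c v) (linear_form v ^ d))
      = (\<Sum>i<card Z. pscale (c (h i)) (linear_form (h i) ^ d))"
    by (rule sum.reindex_bij_betw[OF h, symmetric])
  moreover have "linear_form (h i) ^ d \<in> veronese d" if "i < card Z" for i
  proof -
    have "h i \<noteq> 0"
      using bij_betwE[OF h] assms(2) that by (metis lessThan_iff)
    then show ?thesis by (auto simp: veronese_def)
  qed
  ultimately show ?thesis
    unfolding secant_spans_def
    by (intro CollectI exI[of _ "\<lambda>i. c (h i)"] exI[of _ "\<lambda>i. linear_form (h i) ^ d"]) simp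
qed

lemma form_eq_sum_powers:
  fixes F :: "'n::finite cpoly"
  assumes "F \<in> forms d"
  obtains Z c where "finite Z" "0 \<notin> Z" "F = (\<Sum>v\<in>Z. pscale (c v) (linear_form v ^ d))"
proof -
  obtain Z :: "(complex ^ 'n) set" where Z: "finite Z" "0 \<notin> Z"
    "\<And>\<alpha>. mdeg \<alpha> = d \<Longrightarrow> \<exists>c. monom \<alpha> = (\<Sum>v\<in>Z. pscale (c v) (linear_form v ^ d))"
    by (rule exists_powers_spanning[of d]) blast
  then obtain c where c: "\<And>\<alpha>. mdeg \<alpha> = d \<Longrightarrow> monom \<alpha> = (\<Sum>v\<in>Z. pscale (c \<alpha> v) (linear_form v ^ d))"
    by metis
  have "F = (\<Sum>\<alpha>\<in>Poly_Mapping.keys F. pscale (coef F \<alpha>) (monom \<alpha>))"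
    by (rule poly_eq_sum) auto
  also have "\<dots> = (\<Sum>\<alpha>\<in>Poly_Mapping.keys F. \<Sum>v\<in>Z. pscale (coef F \<alpha> * c \<alpha> v) (linear_form v ^ d))"
    using assms by (intro sum.cong) (auto simp: forms_def c pv.scale_sum_right)
  also have "\<dots> = (\<Sum>v\<in>Z. pscale (\<Sum>\<alpha>\<in>Poly_Mapping.keys F. coef F \<alpha> * c \<alpha> v) (linear_form v ^ d))"
    by (subst sum.swap) (simp add: pv.scale_sum_left)
  finally show thesis by (rule that[OF Z(1,2)])
qed

text \<open>The \<open>LEAST\<close> in the border rank is attained because every form is a finite
  sum of powers.\<close>

lemma in_secant_variety_border_rank:
  assumes "F \<in> forms d"
  shows "F \<in> secant_variety (border_rank d F) d"
proof -
  obtain Z c where "finite Z" "0 \<notin> Z" "F = (\<Sum>v\<in>Z. pscale (c v) (linear_form v ^ d))"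
    by (rule form_eq_sum_powers[OF assms])
  then have "F \<in> secant_spans (card Z) d"
    using secant_spans_sum_powers by simp
  then have "F \<in> secant_variety (card Z) d"
    using assms closure_subset by (fastforce simp: secant_variety_def)
  then show ?thesis
    unfolding border_rank_def by (rule LeastI)
qed

text \<open>Forms of degree d have only finitely many relevant coefficients. Bounding these defines
  open sets of the product topology, and shrinking the bounds gives a sequence; all other
  coefficients are zero throughout.\<close>

lemma secant_variety_sequence:
  fixes F :: "'n::finite cpoly"
  assumes "F \<in> secant_variety r d"
  obtains G where "\<And>k::nat. G k \<in> secant_spans r d" "\<And>\<alpha>. (\<lambda>k. coef (G k) \<alpha>) \<longlonglongrightarrow> coef F \<alpha>"
proof -
  have F: "F \<in> forms d" "coef F \<in> closure (coef ` secant_spans r d)"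
    using assms by (auto simp: secant_variety_def)
  let ?S = "{\<alpha>::'n \<Rightarrow>\<^sub>0 nat. mdeg \<alpha> = d}"
  define U where "U k = (\<Inter>\<alpha>\<in>?S. {f. dist (f \<alpha>) (coef F \<alpha>) < inverse (of_nat (Suc k))})" for k
  have "\<exists>G. G \<in> secant_spans r d \<and> coef G \<in> U k" for k
  proof -
    have "open (U k)"
      unfolding U_def
    proof (intro open_INT ballI finite_mdeg_eq)
      fix \<alpha> :: "'n \<Rightarrow>\<^sub>0 nat"
      have "continuous_on UNIV (\<lambda>f::('n \<Rightarrow>\<^sub>0 nat) \<Rightarrow> complex. f \<alpha>)"
        by (rule continuous_on_product_coordinates)
      then show "open {f. dist (f \<alpha>) (coef F \<alpha>) < inverse (of_nat (Suc k))}"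
        by (intro open_Collect_less continuous_intros)
    qed
    moreover have "coef F \<in> U k"
      by (simp add: U_def)
    ultimately have "U k \<inter> coef ` secant_spans r d \<noteq> {}"
      using F(2) open_Int_closure_eq_empty by blast
    then show ?thesis by blast
  qed
  then obtain G where G: "\<And>k. G k \<in> secant_spans r d" "\<And>k. coef (G k) \<in> U k"
    by metis
  have "(\<lambda>k. coef (G k) \<alpha>) \<longlonglongrightarrow> coef F \<alpha>" for \<alpha>
  proof (cases "mdeg \<alpha> = d")
    case True
    show ?thesis
    proof (rule Lim_transform_bound[OF always_eventually LIMSEQ_inverse_real_of_nat, THEN LIM_zero_cancel])
      show "\<forall>k. norm (coef (G k) \<alpha> - coef F \<alpha>) \<le> norm (inverse (real (Suc k)))"
        using G(2) True by (fastforce simp: U_def dist_norm less_imp_le)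
    qed
  next
    case False
    then have "coef (G k) \<alpha> = coef F \<alpha>" for k
      using G(1)[of k] secant_spans_subset_forms F(1) by (metis formsD subsetD)
    then show ?thesis by simp
  qed
  with G(1) that show thesis by blast
qed


section \<open>Hilbert functions\<close>

lemma homogeneous_idealD:
  assumes "homogeneous_ideal J"
  shows "0 \<in> J" "f \<in> J \<Longrightarrow> g \<in> J \<Longrightarrow> f + g \<in> J" "f \<in> J \<Longrightarrow> g * f \<in> J" "f \<in> J \<Longrightarrow> pscale c f \<in> J"
    "f \<in> J \<Longrightarrow> hom_component m f \<in> J"
  using assms by (auto simp: homogeneous_ideal_def pscale_def)

lemma subspace_homogeneous_ideal: "homogeneous_ideal J \<Longrightarrow> pv.subspace J"
  by (auto simp: pv.subspace_def homogeneous_idealD)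

lemma forms_subset_span: "forms m \<subseteq> pv.span (monom ` {\<alpha>. mdeg \<alpha> = m})"
proof
  fix f :: "'a cpoly" assume "f \<in> forms m"
  then have "f = (\<Sum>\<alpha>\<in>{\<alpha>. mdeg \<alpha> = m}. pscale (coef f \<alpha>) (monom \<alpha>))"
    by (intro poly_eq_sum finite_mdeg_eq keys_forms)
  also have "\<dots> \<in> pv.span (monom ` {\<alpha>. mdeg \<alpha> = m})"
    by (intro pv.span_sum pv.span_scale) (auto intro: pv.span_base)
  finally show "f \<in> pv.span (monom ` {\<alpha>. mdeg \<alpha> = m})" .
qed

text \<open>The whole polynomial ring has infinite dimension, so finiteness of bases has to come
  from the finitely many monomials of one degree.\<close>

lemma finite_independent_forms:
  assumes "pv.independent B" "B \<subseteq> forms m"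
  shows "finite B"
  using pv.independent_span_bound[of "monom ` {\<alpha>. mdeg \<alpha> = m}" B] assms forms_subset_span finite_mdeg_eq
  by blast

lemma independent_card_le_dim:
  assumes "pv.independent B" "B \<subseteq> W" "W \<subseteq> forms m"
  shows "card B \<le> pv.dim W"
proof -
  obtain C where C: "C \<subseteq> W" "pv.independent C" "W \<subseteq> pv.span C" "card C = pv.dim W"
    using pv.basis_exists by blast
  then have "finite C"
    using finite_independent_forms assms(3) by blast
  then show ?thesis
    using pv.independent_span_bound[of C B] assms C by auto
qed

lemma span_image_finite:
  assumes "finite I" "x \<in> pv.span (g ` I)"
  shows "\<exists>c. x = (\<Sum>i\<in>I. pscale (c i) (g i))"
  using assms
proof (induction I arbitrary: x rule: finite_induct)
  case empty
  then show ?case by simp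
next
  case (insert i I)
  then obtain k where "x - pscale k (g i) \<in> pv.span (g ` I)"
    by (auto simp: pv.span_insert)
  then obtain c where c: "x - pscale k (g i) = (\<Sum>i\<in>I. pscale (c i) (g i))"
    using insert.IH by blast
  have "x = (\<Sum>j\<in>insert i I. pscale ((c(i := k)) j) (g j))"
    using insert.hyps c by (auto simp: algebra_simps intro!: sum.cong)
  then show ?case by blast
qed

section \<open>Independence modulo a subspace\<close>

definition indep_mod :: "'n cpoly set \<Rightarrow> 'i set \<Rightarrow> ('i \<Rightarrow> 'n cpoly) \<Rightarrow> bool" where
  "indep_mod W I g \<longleftrightarrow> (\<forall>c. (\<Sum>i\<in>I. pscale (c i) (g i)) \<in> W \<longrightarrow> (\<forall>i\<in>I. c i = 0))"

lemma indep_mod_insertD: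
  assumes "finite I" "i \<notin> I" "indep_mod W (insert i I) g"
  shows "indep_mod W I g"
  unfolding indep_mod_def
proof (intro allI impI ballI)
  fix c j assume c: "(\<Sum>i\<in>I. pscale (c i) (g i)) \<in> W" and j: "j \<in> I"
  have "(\<Sum>j\<in>insert i I. pscale ((c(i := 0)) j) (g j)) = (\<Sum>j\<in>I. pscale (c j) (g j))"
    using assms(1,2) by (auto intro!: sum.cong)
  with c have "(\<Sum>j\<in>insert i I. pscale ((c(i := 0)) j) (g j)) \<in> W"
    by (simp only:)
  then have "\<forall>j\<in>insert i I. (c(i := 0)) j = 0"
    using assms(3) unfolding indep_mod_def by blast
  then show "c j = 0"
    using assms(2) j by (auto split: if_splits)
qed

text \<open>Dimension counts in a quotient are carried out without forming it: a family independent
  modulo \<open>W\<close> extends any basis of \<open>W\<close>, and repeated values in the family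
  are excluded, so cardinalities add.\<close>

lemma indep_mod_union_basis:
  assumes "finite I" "pv.independent B" "finite B" "B \<subseteq> W" "W \<subseteq> pv.span B" "pv.subspace W" "indep_mod W I g"
  shows "pv.independent (B \<union> g ` I) \<and> card (B \<union> g ` I) = card B + card I"
  using assms(1,7)
proof (induction I rule: finite_induct)
  case empty
  then show ?case using assms by simp
next
  case (insert i I)
  have IH: "pv.independent (B \<union> g ` I)" "card (B \<union> g ` I) = card B + card I"
    using insert.IH[OF indep_mod_insertD[OF insert.hyps insert.prems]] by auto
  have "g i \<notin> pv.span (B \<union> g ` I)"
  proof
    assume "g i \<in> pv.span (B \<union> g ` I)"
    then obtain b x where b: "b \<in> pv.span B" "x \<in> pv.span (g ` I)" "g i = b + x"
      by (auto simp: pv.span_Un)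
    then obtain c where c: "x = (\<Sum>i\<in>I. pscale (c i) (g i))"
      using span_image_finite[OF insert.hyps(1)] by blast
    have "(\<Sum>j\<in>I. pscale (((\<lambda>j. - c j)(i := 1)) j) (g j)) = (\<Sum>j\<in>I. - pscale (c j) (g j))"
      using insert.hyps by (intro sum.cong) auto
    then have "(\<Sum>j\<in>insert i I. pscale (((\<lambda>j. - c j)(i := 1)) j) (g j)) = g i - (\<Sum>j\<in>I. pscale (c j) (g j))"
      using insert.hyps by (simp add: sum_negf)
    also have "\<dots> = b" using b(3) c by simp
    also have "b \<in> W" using b(1) assms(4,6) by (meson pv.span_minimal subsetD)
    finally have "\<forall>j\<in>insert i I. ((\<lambda>j. - c j)(i := 1)) j = 0"
      using insert.prems unfolding indep_mod_def by blast
    then show False by simp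
  qed
  then have "pv.independent (insert (g i) (B \<union> g ` I))" "g i \<notin> B \<union> g ` I"
    using IH(1) by (auto simp: pv.independent_insertI pv.span_base)
  then show ?case
    using IH(2) insert.hyps assms(3) by simp
qed

lemma indep_mod_card_le:
  assumes "finite I" "pv.subspace W" "W \<subseteq> forms m" "indep_mod W I g" "g ` I \<subseteq> forms m"
  shows "card I \<le> pv.dim (forms m :: 'n::finite cpoly set) - pv.dim (W :: 'n cpoly set)"
proof -
  obtain B where B: "B \<subseteq> W" "pv.independent B" "W \<subseteq> pv.span B" "card B = pv.dim W"
    using pv.basis_exists by blast
  have fin: "finite B"
    using finite_independent_forms B assms(3) by blast
  note u = indep_mod_union_basis[OF assms(1) B(2) fin B(1,3) assms(2,4)]
  have "card (B \<union> g ` I) \<le> pv.dim (forms m :: 'n cpoly set)"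
    using u B assms by (intro independent_card_le_dim) auto
  with u B(4) show ?thesis by simp
qed

lemma hilbert_function_ge:
  assumes "homogeneous_ideal J" "finite I" "indep_mod (J \<inter> forms m) I g" "g ` I \<subseteq> forms m"
  shows "card I \<le> hilbert_function J m"
  unfolding hilbert_function_def
  using assms by (intro indep_mod_card_le pv.subspace_inter subspace_homogeneous_ideal subspace_forms) auto

lemma hilbert_function_eq:
  assumes "homogeneous_ideal J" "finite I" "indep_mod (J \<inter> forms m) I g" "g ` I \<subseteq> forms m"
    and span: "\<And>f. f \<in> forms m \<Longrightarrow> \<exists>c. f - (\<Sum>i\<in>I. pscale (c i) (g i)) \<in> J"
  shows "hilbert_function J m = card I"
proof -
  let ?W = "J \<inter> forms m"
  obtain B where B: "B \<subseteq> ?W" "pv.independent B" "?W \<subseteq> pv.span B" "card B = pv.dim ?W"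
    using pv.basis_exists by blast
  have fin: "finite B"
    using finite_independent_forms B by blast
  have sub: "pv.subspace ?W"
    using assms(1) by (intro pv.subspace_inter subspace_homogeneous_ideal subspace_forms)
  note u = indep_mod_union_basis[OF assms(2) B(2) fin B(1,3) sub assms(3)]
  have "forms m \<subseteq> pv.span (B \<union> g ` I)"
  proof
    fix f :: "'a cpoly" assume f: "f \<in> forms m"
    then obtain c where c: "f - (\<Sum>i\<in>I. pscale (c i) (g i)) \<in> J"
      using span by blast
    moreover have "f - (\<Sum>i\<in>I. pscale (c i) (g i)) \<in> forms m"
      using f assms(4) by (intro forms_diff forms_sum forms_pscale) auto
    ultimately have "f - (\<Sum>i\<in>I. pscale (c i) (g i)) \<in> pv.span B"
      using B(3) by blast
    moreover have "(\<Sum>i\<in>I. pscale (c i) (g i)) \<in> pv.span (g ` I)"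
      by (intro pv.span_sum pv.span_scale pv.span_base) auto
    ultimately have "f - (\<Sum>i\<in>I. pscale (c i) (g i)) + (\<Sum>i\<in>I. pscale (c i) (g i)) \<in> pv.span (B \<union> g ` I)"
      by (intro pv.span_add) (auto intro: subsetD[OF pv.span_mono, rotated])
    then show "f \<in> pv.span (B \<union> g ` I)" by simp
  qed
  then have "pv.dim (forms m :: 'a cpoly set) = card (B \<union> g ` I)"
    using u B(1) assms(4) by (intro pv.dim_unique[of "B \<union> g ` I"]) auto
  then show ?thesis
    using u B(4) by (simp add: hilbert_function_def)
qed


section \<open>Linear forms that are regular modulo a zero-dimensional scheme\<close>

lemma homogeneous_ideal_sum:
  "homogeneous_ideal J \<Longrightarrow> (\<And>x. x \<in> S \<Longrightarrow> f x \<in> J) \<Longrightarrow> sum f S \<in> J"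
  by (rule pv.subspace_sum[OF subspace_homogeneous_ideal])

lemma var_power: "var i ^ k = monom (Poly_Mapping.single i k)"
  by (induction k) (simp_all add: var_def monom_mult single_add[symmetric])

text \<open>In each term of the binomial expansion either the exponent of \<open>x\<close> is at
  least j or that of \<open>z\<close> is at least k.\<close>

lemma power_add_mult_in_ideal:
  assumes J: "homogeneous_ideal J" and "x ^ j * f \<in> J" "z ^ k * f \<in> J"
  shows "(x + z) ^ (j + k) * f \<in> J"
proof -
  have "of_nat (j + k choose i) * x ^ i * z ^ (j + k - i) * f \<in> J" if "i \<le> j + k" for i
  proof (cases "j \<le> i")
    case True
    then have "of_nat (j + k choose i) * x ^ i * z ^ (j + k - i) * f
        = (of_nat (j + k choose i) * x ^ (i - j) * z ^ (j + k - i)) * (x ^ j * f)"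
      using power_add[of x "i - j" j] by (simp add: ac_simps)
    then show ?thesis
      using homogeneous_idealD(3)[OF J assms(2)] by simp
  next
    case False
    then have "j + k - i = (j - i) + k" by simp
    then have "of_nat (j + k choose i) * x ^ i * z ^ (j + k - i) * f
        = (of_nat (j + k choose i) * x ^ i * z ^ (j - i)) * (z ^ k * f)"
      by (simp add: power_add ac_simps)
    then show ?thesis
      using homogeneous_idealD(3)[OF J assms(3)] by simp
  qed
  then show ?thesis
    unfolding binomial_ring sum_distrib_right
    by (intro homogeneous_ideal_sum[OF J]) auto
qed

text \<open>Pigeonhole: a monomial whose degree is the sum of the \<open>j i\<close> has some
  exponent of size at least \<open>j i\<close>. Hence saturation can be tested on powers of single
  variables.\<close>

lemma saturated_var_power:
  fixes J :: "'n::finite cpoly set"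
  assumes J: "homogeneous_ideal J" "saturated J" and "\<And>i. \<exists>j. var i ^ j * f \<in> J"
  shows "f \<in> J"
proof -
  obtain j where j: "\<And>i. var i ^ j i * f \<in> J"
    using assms(3) by metis
  have monom: "monom \<gamma> * f \<in> J" if "mdeg \<gamma> = sum j UNIV" for \<gamma> :: "'n \<Rightarrow>\<^sub>0 nat"
  proof -
    have "\<exists>i. j i \<le> expo \<gamma> i"
    proof (rule ccontr)
      assume "\<nexists>i. j i \<le> expo \<gamma> i"
      then have "mdeg \<gamma> < sum j UNIV"
        unfolding mdeg_def by (intro sum_strict_mono) (auto simp: not_le)
      with that show False by simp
    qed
    then obtain i where i: "j i \<le> expo \<gamma> i" ..
    have "\<gamma> = (\<gamma> - Poly_Mapping.single i (j i)) + Poly_Mapping.single i (j i)"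
      using i by (intro poly_mapping_eqI) (auto simp: lookup_add lookup_minus lookup_single when_def)
    then have "monom \<gamma> = monom (\<gamma> - Poly_Mapping.single i (j i)) * var i ^ j i"
      by (simp add: var_power monom_mult)
    then show ?thesis
      using homogeneous_idealD(3)[OF J(1) j] by (simp add: mult.assoc)
  qed
  have "g * f \<in> J" if g: "g \<in> forms (sum j UNIV)" for g
  proof -
    have "g = (\<Sum>\<alpha>\<in>Poly_Mapping.keys g. pscale (coef g \<alpha>) (monom \<alpha>))"
      by (rule poly_eq_sum) auto
    then have "g * f = (\<Sum>\<alpha>\<in>Poly_Mapping.keys g. pscale (coef g \<alpha>) (monom \<alpha> * f))"
      by (metis (no_types, lifting) pscale_mult_left sum.cong sum_distrib_right)
    also have "\<dots> \<in> J"
      using g by (intro homogeneous_ideal_sum homogeneous_idealD(4) J monom) (auto simp: forms_def)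
    finally show ?thesis .
  qed
  then show ?thesis
    using J(2) unfolding saturated_def by blast
qed

text \<open>The ideal quotient of \<open>J\<close> by all powers of \<open>l\<close>. For an ideal
  \<open>J\<close>, \<open>l\<close> is regular modulo \<open>J\<close> exactly when this is
  \<open>J\<close> itself.\<close>

definition torsion :: "'n::finite cpoly set \<Rightarrow> 'n cpoly \<Rightarrow> 'n cpoly set" where
  "torsion J l = {g. \<exists>j. l ^ j * g \<in> J}"

lemma torsionI: "l ^ j * g \<in> J \<Longrightarrow> g \<in> torsion J l"
  by (auto simp: torsion_def)

context
  fixes J :: "'n::finite cpoly set"
  assumes J: "homogeneous_ideal J"
begin

lemma subset_torsion: "J \<subseteq> torsion J l"
  using torsionI[of l 0] by auto

lemma torsion_mult: "g \<in> torsion J l \<Longrightarrow> h * g \<in> torsion J l"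
  using homogeneous_idealD(3)[OF J, of _ h] unfolding torsion_def by (fastforce simp: mult.left_commute[of _ h])

lemma torsion_add:
  assumes "f \<in> torsion J l" "g \<in> torsion J l"
  shows "f + g \<in> torsion J l"
proof -
  obtain i j where "l ^ i * f \<in> J" "l ^ j * g \<in> J"
    using assms by (auto simp: torsion_def)
  then have "l ^ j * (l ^ i * f) + l ^ i * (l ^ j * g) \<in> J"
    using homogeneous_idealD[OF J] by blast
  then have "l ^ (i + j) * (f + g) \<in> J"
    by (simp add: power_add algebra_simps)
  then show ?thesis by (rule torsionI)
qed

lemma subspace_torsion: "pv.subspace (torsion J l)"
  using subset_torsion homogeneous_idealD(1)[OF J] torsion_mult
  by (auto simp: pv.subspace_def torsion_add pscale_def)

lemma torsion_cancel:
  assumes "l ^ k * g \<in> torsion J l"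
  shows "g \<in> torsion J l"
proof -
  obtain j where "l ^ j * (l ^ k * g) \<in> J"
    using assms by (auto simp: torsion_def)
  then have "l ^ (j + k) * g \<in> J"
    by (simp add: power_add mult.assoc)
  then show ?thesis by (rule torsionI)
qed

lemma torsion_pscale_cancel:
  assumes "pscale c g \<in> torsion J l" "c \<noteq> 0"
  shows "g \<in> torsion J l"
  using pv.subspace_scale[OF subspace_torsion assms(1), of "1 / c"] assms(2) by simp

text \<open>Two different members of the pencil have a nonzero multiple of \<open>l\<close> as a
  combination. If both killed \<open>h\<close>, so would \<open>l\<close>, and \<open>h\<close>
  would be torsion.\<close>

lemma torsion_pencil:
  assumes ts: "t \<noteq> s" "t \<noteq> 0" and h: "(l + pscale t y) * h \<in> torsion J l" "h \<notin> torsion J l"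
  shows "(l + pscale s y) * h \<notin> torsion J l"
proof
  assume s: "(l + pscale s y) * h \<in> torsion J l"
  have "pscale t ((l + pscale s y) * h) - pscale s ((l + pscale t y) * h) = pscale (t - s) (l * h)"
    by (simp add: pscale_mult_left distrib_right pv.scale_right_distrib pv.scale_left_diff_distrib
        mult.commute[of t s])
  moreover have "pscale t ((l + pscale s y) * h) - pscale s ((l + pscale t y) * h) \<in> torsion J l"
    using s h(1) by (intro pv.subspace_diff pv.subspace_scale subspace_torsion)
  ultimately have "l * h \<in> torsion J l"
    using ts(1) torsion_pscale_cancel[of "t - s"] by simp
  then show False
    using torsion_cancel[of l 1] h(2) by simp
qed

text \<open>
  The degrees are unbounded here. If \<open>l + sy\<close> kills a nonzero class modulo torsion, then that class behaves like an
  eigenvector of \<open>l/y\<close> for the eigenvalue \<open>-s\<close>; after multiplication by powers of \<open>l\<close> all such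
  classes live in one degree, where they are independent, so there are at most \<open>r\<close> values \<open>s \<noteq> 0\<close> to avoid.
\<close>

lemma exists_regular_in_pencil:
  assumes hf: "\<And>m. m \<ge> M \<Longrightarrow> hilbert_function J m \<le> r" and l: "l \<in> forms 1"
  shows "\<exists>s. s \<noteq> 0 \<and>
    (\<forall>m\<ge>M. \<forall>g\<in>forms m. (l + pscale s y) * g \<in> torsion J l \<longrightarrow> g \<in> torsion J l)"
proof (rule ccontr)
  assume contra: "\<not> ?thesis"
  \<comment> \<open>One value more than the number of classes that can be independent in a single
    degree.\<close>
  let ?S = "{1..Suc r}"
  let ?a = "\<lambda>s::nat. l + pscale (of_nat s) y"
  have "\<exists>m g. m \<ge> M \<and> g \<in> forms m \<and> ?a s * g \<in> torsion J l \<and> g \<notin> torsion J l" if "s \<in> ?S" for s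
  proof -
    have "(of_nat s :: complex) \<noteq> 0" using that by simp
    then show ?thesis using contra by blast
  qed
  then obtain m g where g: "\<And>s. s \<in> ?S \<Longrightarrow> m s \<ge> M" "\<And>s. s \<in> ?S \<Longrightarrow> g s \<in> forms (m s)"
    "\<And>s. s \<in> ?S \<Longrightarrow> ?a s * g s \<in> torsion J l" "\<And>s. s \<in> ?S \<Longrightarrow> g s \<notin> torsion J l"
    by metis
  define N where "N = Max (m ` ?S)"
  have N: "m s \<le> N" if "s \<in> ?S" for s
    unfolding N_def using that by (intro Max_ge) auto
  \<comment> \<open>Powers of \<open>l\<close> lift all witnesses to the common degree N, and
    \<open>torsion_cancel\<close> keeps them outside the torsion.\<close>
  define G where "G s = l ^ (N - m s) * g s" for s
  have "N \<ge> M"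
    using N[of 1] g(1)[of 1] by simp
  have G_forms: "G s \<in> forms N" if "s \<in> ?S" for s
    using forms_mult[OF forms_power[OF l, of "N - m s"] g(2)[OF that]] N[OF that] by (simp add: G_def)
  have G_torsion: "?a s * G s \<in> torsion J l" if "s \<in> ?S" for s
    using torsion_mult[OF g(3)[OF that], of "l ^ (N - m s)"] by (simp add: G_def ac_simps)
  have G_not: "G s \<notin> torsion J l" if "s \<in> ?S" for s
    using torsion_cancel g(4)[OF that] by (auto simp: G_def)
  have "\<not> indep_mod (J \<inter> forms N) ?S G"
  proof
    assume "indep_mod (J \<inter> forms N) ?S G"
    then have "card ?S \<le> hilbert_function J N"
      using J G_forms by (intro hilbert_function_ge) auto
    then show False using hf[OF \<open>N \<ge> M\<close>] by simp
  qed
  then obtain c t where c: "(\<Sum>s\<in>?S. pscale (c s) (G s)) \<in> J" and t: "t \<in> ?S" "c t \<noteq> 0"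
    by (auto simp: indep_mod_def)
  \<comment> \<open>As in the independence of eigenvectors, the product over all values other than t
    kills every \<open>G s\<close> with s different from t but not \<open>G t\<close>, isolating one
    term of the relation.\<close>
  define P where "P A = (\<Prod>s\<in>A. ?a s)" for A
  have not_P: "P A * G t \<notin> torsion J l" if "finite A" "A \<subseteq> ?S - {t}" for A
    using that
  proof (induction A rule: finite_induct)
    case empty
    then show ?case using G_not[OF t(1)] by (simp add: P_def)
  next
    case (insert s A)
    have "?a t * (P A * G t) \<in> torsion J l"
      using torsion_mult[OF G_torsion[OF t(1)], of "P A"] by (simp add: ac_simps)
    then have "?a s * (P A * G t) \<notin> torsion J l"
      using insert t(1) by (intro torsion_pencil[of "of_nat t"]) auto
    then show ?case
      using insert.hyps by (simp add: P_def mult.assoc)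
  qed
  let ?P = "P (?S - {t})"
  have killed: "?P * G s \<in> torsion J l" if "s \<in> ?S - {t}" for s
  proof -
    have "?P = P (?S - {t} - {s}) * ?a s"
      unfolding P_def using that by (subst prod.remove[of _ s]) (auto simp: mult.commute)
    then show ?thesis
      using torsion_mult[OF G_torsion[of s]] that by (simp add: mult.assoc)
  qed
  have "?P * (\<Sum>s\<in>?S. pscale (c s) (G s)) \<in> torsion J l"
    using c subset_torsion by (intro torsion_mult) auto
  also have "?P * (\<Sum>s\<in>?S. pscale (c s) (G s)) = (\<Sum>s\<in>?S. pscale (c s) (?P * G s))"
    by (simp only: sum_distrib_left pscale_mult_right)
  also have "\<dots> = pscale (c t) (?P * G t) + (\<Sum>s\<in>?S - {t}. pscale (c s) (?P * G s))"
    using t(1) by (intro sum.remove) auto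
  finally have sum: "pscale (c t) (?P * G t) + (\<Sum>s\<in>?S - {t}. pscale (c s) (?P * G s)) \<in> torsion J l" .
  have "(\<Sum>s\<in>?S - {t}. pscale (c s) (?P * G s)) \<in> torsion J l"
    using killed by (intro pv.subspace_sum pv.subspace_scale subspace_torsion)
  from pv.subspace_diff[OF subspace_torsion sum this] have "pscale (c t) (?P * G t) \<in> torsion J l"
    by simp
  then show False
    using torsion_pscale_cancel t(2) not_P[of "?S - {t}"] by blast
qed

text \<open>Choose \<open>v\<close> with torsion of least dimension in degree M. If a torsion
  element \<open>f\<close> lay outside \<open>J\<close>, saturation would give a variable none of
  whose powers carries \<open>f\<close> into \<open>J\<close>. Perturbing \<open>v\<close> along
  this variable by a suitable s would keep the torsion inside the old one and lose \<open>f\<close>,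
  against minimality.\<close>

lemma exists_regular_linear_form:
  assumes sat: "saturated J" and hf: "\<And>m. m \<ge> M \<Longrightarrow> hilbert_function J m \<le> r"
  obtains v where "\<And>m g j. m \<le> M \<Longrightarrow> g \<in> forms m \<Longrightarrow> linear_form v ^ j * g \<in> J \<Longrightarrow> g \<in> J"
proof -
  let ?K = "\<lambda>v. torsion J (linear_form v) \<inter> forms M"
  obtain v where v: "\<And>w. pv.dim (?K v) \<le> pv.dim (?K w)"
    using ex_has_least_nat[where P = "\<lambda>_. True" and m = "\<lambda>v. pv.dim (?K v)"] by auto
  let ?l = "linear_form v"
  have K: "f \<in> J" if f: "f \<in> ?K v" for f
  proof (rule ccontr)
    assume "f \<notin> J"
    then obtain i where i: "\<And>j. var i ^ j * f \<notin> J"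
      using saturated_var_power[OF J sat] by blast
    obtain s where s: "s \<noteq> 0"
      "\<And>m g. m \<ge> M \<Longrightarrow> g \<in> forms m \<Longrightarrow> (?l + pscale s (var i)) * g \<in> torsion J ?l \<Longrightarrow> g \<in> torsion J ?l"
      using exists_regular_in_pencil[of M r ?l "var i", OF hf linear_form_in_forms] by blast
    define w where "w = v + s *s axis i 1"
    have w: "linear_form w = ?l + pscale s (var i)"
      by (simp add: w_def linear_form_add linear_form_cmul linear_form_axis)
    \<comment> \<open>Powers of the perturbed form raise the degree arbitrarily, so s has to work in
      all degrees from M on.\<close>
    have cancel: "linear_form w ^ j * g \<in> torsion J ?l \<Longrightarrow> g \<in> forms M \<Longrightarrow> g \<in> torsion J ?l" for j g
    proof (induction j)
      case (Suc j)
      have "linear_form w ^ j * g \<in> forms (j + M)"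
        using forms_mult[OF linear_form_power_in_forms Suc.prems(2)] .
      then have "linear_form w ^ j * g \<in> torsion J ?l"
        using Suc.prems(1) s(2)[of "j + M"] by (simp add: w mult.assoc)
      then show ?case using Suc by blast
    qed simp
    have sub: "?K w \<subseteq> ?K v"
    proof
      fix g assume g: "g \<in> ?K w"
      then obtain j where "linear_form w ^ j * g \<in> J"
        by (auto simp: torsion_def)
      then have "linear_form w ^ j * g \<in> torsion J ?l"
        using subset_torsion by blast
      then show "g \<in> ?K v" using cancel g by blast
    qed
    have "f \<notin> ?K w"
    proof
      assume "f \<in> ?K w"
      then obtain j where j: "linear_form w ^ j * f \<in> J" by (auto simp: torsion_def)
      obtain k where k: "?l ^ k * f \<in> J" using f by (auto simp: torsion_def)
      \<comment> \<open>If powers of both the old and the new linear form carry \<open>f\<close>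
        into \<open>J\<close>, then so does a power of their difference, a nonzero multiple of the
        chosen variable.\<close>
      have "(- ?l) ^ k * f \<in> J"
        using homogeneous_idealD(3)[OF J k, of "(- 1) ^ k"] by (simp add: power_minus[of ?l] mult.assoc)
      from power_add_mult_in_ideal[OF J j this]
      have "pscale (s ^ (j + k)) (var i ^ (j + k) * f) \<in> J"
        by (simp add: w pscale_power pscale_mult_left)
      then have "var i ^ (j + k) * f \<in> J"
        using homogeneous_idealD(4)[OF J, of _ "1 / s ^ (j + k)"] s(1) by fastforce
      with i show False by blast
    qed
    obtain B where B: "B \<subseteq> ?K w" "pv.independent B" "?K w \<subseteq> pv.span B" "card B = pv.dim (?K w)"
      using pv.basis_exists by blast
    have "pv.subspace (?K w)"
      by (intro pv.subspace_inter subspace_torsion subspace_forms)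
    then have "f \<notin> pv.span B"
      using \<open>f \<notin> ?K w\<close> pv.span_minimal[OF B(1)] by blast
    then have indep: "pv.independent (insert f B)" and "f \<notin> B"
      using B(2) by (auto simp: pv.independent_insertI pv.span_base)
    have "finite B"
      using finite_independent_forms B(1,2) by blast
    have "card (insert f B) \<le> pv.dim (?K v)"
      using indep B(1) sub f by (intro independent_card_le_dim[of _ _ M]) auto
    then show False
      using v[of w] B(4) \<open>f \<notin> B\<close> \<open>finite B\<close> by simp
  qed
  show thesis
  proof
    fix m g j assume m: "m \<le> M" and g: "g \<in> forms m" "?l ^ j * g \<in> J"
    \<comment> \<open>Degrees below M are lifted to degree M, and saturation brings the conclusion
      back down.\<close>
    have "h * g \<in> J" if h: "h \<in> forms (M - m)" for h
    proof (rule K, intro IntI)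
      show "h * g \<in> forms M"
        using forms_mult[OF h g(1)] m by simp
      have "?l ^ j * (h * g) \<in> J"
        using homogeneous_idealD(3)[OF J g(2), of h] by (simp add: ac_simps)
      then show "h * g \<in> torsion J ?l" by (rule torsionI)
    qed
    then show "g \<in> J"
      using sat unfolding saturated_def by blast
  qed
qed

end


section \<open>Short apolar schemes force a nonvanishing Hessian\<close>

lemma sum_linear_form_mult: "linear_form a * p = (\<Sum>i\<in>UNIV. pscale (a $ i) (var i * p))"
  by (simp add: linear_form_def sum_distrib_right pscale_mult_left)

lemma apair_linear_linear_power:
  assumes "F \<in> forms (Suc (Suc m))"
  shows "apair (linear_form a * linear_form b * linear_form v ^ m) F
    = fact m * (\<Sum>i\<in>UNIV. a $ i * (hessian_at F v *v b) $ i)"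
proof -
  have "linear_form a * linear_form b * linear_form v ^ m
      = linear_form a * (linear_form b * linear_form v ^ m)"
    by (rule mult.assoc)
  also have "\<dots> = (\<Sum>i\<in>UNIV. pscale (a $ i) (\<Sum>j\<in>UNIV. pscale (b $ j) (var i * var j * linear_form v ^ m)))"
    unfolding sum_linear_form_mult[of a] sum_linear_form_mult[of b]
    by (simp only: sum_distrib_left pscale_mult_right mult.assoc)
  finally show ?thesis
    using apair_var_var_power[OF assms]
    by (simp add: apair_sum_left apair_pscale_left matrix_vector_mult_def sum_distrib_left ac_simps)
qed

lemma det_eq_0_imp_kernel:
  fixes A :: "'a::field ^ 'n ^ 'n"
  assumes "det A = 0"
  obtains x where "x \<noteq> 0" "A *v x = 0"
  using assms by (metis invertible_det_nz invertible_left_inverse matrix_left_invertible_ker)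

lemma concise_linear_form:
  assumes "concise F" "diff_act (linear_form v) F = 0"
  shows "v = 0"
proof -
  have "linear_form v \<in> Ann F \<inter> forms 1"
    using assms(2) linear_form_in_forms by (simp add: Ann_def)
  then have "linear_form v = 0"
    using assms(1) unfolding concise_def by blast
  then show ?thesis by simp
qed

text \<open>The span only tests elements of degree d. Multiplying \<open>h\<close> by monomials up
  to degree d tests all coefficients of its derivative of \<open>F\<close>.\<close>

lemma diff_act_eq_0_of_linear_span:
  assumes J: "homogeneous_ideal J" and F: "F \<in> linear_span d J" and h: "h \<in> J" "h \<in> forms m" "m \<le> d"
  shows "diff_act h F = 0"
proof -
  have "F \<in> forms (m + (d - m))"
    using F h(3) by (simp add: linear_span_def)
  moreover have "apair (monom \<gamma> * h) F = 0" if "mdeg \<gamma> = d - m" for \<gamma>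
  proof -
    have "monom \<gamma> * h \<in> J \<inter> forms d"
      using forms_mult[OF forms_single[OF that] h(2)] homogeneous_idealD(3)[OF J h(1)] h(3) by simp
    then show ?thesis
      using F by (simp add: linear_span_def apair_def)
  qed
  ultimately show ?thesis
    using diff_act_form_eq_0_iff[OF h(2)] by blast
qed

lemma Hess_nonzero_of_short_scheme:
  fixes F :: "'n::finite cpoly"
  assumes d: "d \<ge> 2" and F: "F \<in> forms d" "concise F"
    and J: "zero_dim_scheme r J" "F \<in> linear_span d J" and r: "r \<le> CARD('n)"
  shows "Hess F \<noteq> 0"
proof
  assume Hess: "Hess F = 0"
  have hom: "homogeneous_ideal J" and sat: "saturated J"
    using J(1) by (auto simp: zero_dim_scheme_def)
  obtain m0 where m0: "\<And>m. m \<ge> m0 \<Longrightarrow> hilbert_function J m = r"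
    using J(1) by (auto simp: zero_dim_scheme_def)
  define M where "M = max m0 d"
  have M: "M \<ge> d" "\<And>m. m \<ge> M \<Longrightarrow> hilbert_function J m \<le> r"
    using m0 by (auto simp: M_def)
  obtain v where cancel: "\<And>m g j. m \<le> M \<Longrightarrow> g \<in> forms m \<Longrightarrow> linear_form v ^ j * g \<in> J \<Longrightarrow> g \<in> J"
    using exists_regular_linear_form[OF hom sat M(2)] by metis
  let ?l = "linear_form v"
  have "det (hessian_at F v) = 0"
    using Hess peval_Hess[of F v] by simp
  then obtain f where f: "f \<noteq> 0" "hessian_at F v *v f = 0"
    by (rule det_eq_0_imp_kernel)
  have F2: "F \<in> forms (Suc (Suc (d - 2)))" using F(1) d by (simp add: numeral_2_eq_2 Suc_diff_Suc)
  have F1: "F \<in> forms (1 + (d - 1))" using F(1) d by simp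
  have "apair (monom \<gamma> * linear_form f) F = 0" if \<gamma>: "mdeg \<gamma> = d - 1" for \<gamma> :: "'n \<Rightarrow>\<^sub>0 nat"
  proof -
    \<comment> \<open>One monomial of degree d - 1 together with the padded variables, all lifted to
      degree M: \<open>CARD('n) + 1\<close> elements where at most \<open>CARD('n)\<close> can be
      independent modulo \<open>J\<close>. Cancelling the power of the regular form turns the
      dependence into one in degree d - 1.\<close>
    define g where "g = case_option (?l ^ (M - (d - 1)) * monom \<gamma>) (\<lambda>i. ?l ^ (M - 1) * var i)"
    have g: "g i \<in> forms M" for i
      using d M(1) forms_mult[OF linear_form_power_in_forms forms_single[OF \<gamma>, of 1], of v "M - (d - 1)"]
        forms_mult[OF linear_form_power_in_forms var_in_forms, of v "M - 1"]
      by (auto simp: g_def split: option.split)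
    have "\<not> indep_mod (J \<inter> forms M) (UNIV :: 'n option set) g"
    proof
      assume "indep_mod (J \<inter> forms M) (UNIV :: 'n option set) g"
      then have "CARD('n option) \<le> hilbert_function J M"
        using g hom by (intro hilbert_function_ge) auto
      then show False
        using M(2)[of M] r by (simp add: card_UNIV_option)
    qed
    then obtain c where c: "(\<Sum>i\<in>UNIV. pscale (c i) (g i)) \<in> J" "\<exists>i. c i \<noteq> 0"
      by (auto simp: indep_mod_def)
    define w where "w = (\<chi> i. c (Some i))"
    define q where "q = pscale (c None) (monom \<gamma>) + ?l ^ (d - 2) * linear_form w"
    have "d - 2 + 1 = d - 1" using d by simp
    then have "?l ^ (d - 2) * linear_form w \<in> forms (d - 1)"
      using forms_mult[OF linear_form_power_in_forms linear_form_in_forms, of v "d - 2" w] by simp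
    then have q: "q \<in> forms (d - 1)"
      unfolding q_def by (intro forms_add forms_pscale forms_single \<gamma>)
    have "M - 1 = (M - (d - 1)) + (d - 2)" using d M(1) by simp
    then have "?l ^ (M - 1) = ?l ^ (M - (d - 1)) * ?l ^ (d - 2)" by (simp add: power_add)
    then have "(\<Sum>i\<in>UNIV. pscale (c i) (g i)) = ?l ^ (M - (d - 1)) * q"
      by (simp add: UNIV_option_conv sum.reindex g_def q_def w_def linear_form_def distrib_left
          sum_distrib_left pscale_mult_right mult.assoc)
    then have qJ: "q \<in> J"
      using c(1) cancel[OF _ q] M(1) by simp
    \<comment> \<open>Otherwise cancellation would put a linear form into \<open>J\<close>; it would
      annihilate \<open>F\<close>, and conciseness would make all coefficients zero.\<close>
    have "c None \<noteq> 0"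
    proof
      assume "c None = 0"
      then have "?l ^ (d - 2) * linear_form w \<in> J"
        using qJ by (simp add: q_def)
      then have "linear_form w \<in> J"
        using cancel[OF _ linear_form_in_forms] M(1) d by simp
      then have "diff_act (linear_form w) F = 0"
        using diff_act_eq_0_of_linear_span[OF hom J(2) _ linear_form_in_forms] d by simp
      then have "w = 0" by (rule concise_linear_form[OF F(2)])
      then have "c i = 0" for i
        using \<open>c None = 0\<close> by (cases i) (auto simp: w_def vec_eq_iff)
      with c(2) show False by blast
    qed
    \<comment> \<open>Pairing \<open>linear_form f * q\<close> with \<open>F\<close> gives zero, and
      its padded linear part contributes zero because \<open>f\<close> lies in the kernel of the
      Hessian matrix. Only the monomial term remains.\<close>
    have "linear_form f * q \<in> J" "linear_form f * q \<in> forms d"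
      using homogeneous_idealD(3)[OF hom qJ] forms_mult[OF linear_form_in_forms q] d by auto
    then have "apair (linear_form f * q) F = 0"
      using J(2) by (simp add: linear_span_def apair_def)
    moreover have "apair (linear_form w * linear_form f * ?l ^ (d - 2)) F = 0"
      by (simp add: apair_linear_linear_power[OF F2] f(2))
    ultimately show ?thesis
      using \<open>c None \<noteq> 0\<close>
      by (simp add: q_def distrib_left apair_add_left pscale_mult_right apair_pscale_left ac_simps)
  qed
  then have "diff_act (linear_form f) F = 0"
    using diff_act_form_eq_0_iff[OF linear_form_in_forms F1] by blast
  then show False
    using concise_linear_form[OF F(2)] f(1) by blast
qed


section \<open>Homogeneous parts of ideals\<close>

definition is_ideal :: "'n cpoly set \<Rightarrow> bool" where
  "is_ideal N \<longleftrightarrow> 0 \<in> N \<and> (\<forall>f\<in>N. \<forall>g\<in>N. f + g \<in> N) \<and> (\<forall>f\<in>N. \<forall>g. g * f \<in> N)"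

text \<open>For an ideal this is the largest homogeneous ideal inside it. It leads from affine
  representatives of points, cut out by a non-homogeneous ideal, to the projective scheme.\<close>

definition graded_part :: "'n::finite cpoly set \<Rightarrow> 'n cpoly set" where
  "graded_part N = {h. \<forall>m. hom_component m h \<in> N}"

lemma graded_part_form: "is_ideal N \<Longrightarrow> h \<in> forms m \<Longrightarrow> h \<in> graded_part N \<longleftrightarrow> h \<in> N"
  by (auto simp: graded_part_def is_ideal_def hom_component_form split: if_splits)

lemma graded_part_form_mult:
  assumes "is_ideal N" "g \<in> forms k" "f \<in> graded_part N"
  shows "g * f \<in> graded_part N"
  using assms by (auto simp: graded_part_def hom_component_form_mult[OF assms(2)] is_ideal_def)

lemma homogeneous_ideal_graded_part:
  assumes N: "is_ideal N"
  shows "homogeneous_ideal (graded_part N)"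
proof -
  have add: "f + g \<in> graded_part N" if "f \<in> graded_part N" "g \<in> graded_part N" for f g
    using that N by (auto simp: graded_part_def hom_component_add is_ideal_def)
  have mult: "g * f \<in> graded_part N" if "f \<in> graded_part N" for f g
  proof (induction g rule: poly_induct)
    case (single \<alpha> c)
    show ?case
      using graded_part_form_mult[OF N forms_single[OF refl] that] .
  qed (simp add: distrib_right add)
  show ?thesis
    using N unfolding homogeneous_ideal_def
    by (auto simp: add mult)
      (auto simp: graded_part_def is_ideal_def hom_component_form[OF hom_component_in_forms])
qed

lemma saturated_graded_part:
  assumes N: "is_ideal N" and sat: "\<And>k f. (\<And>g. g \<in> forms k \<Longrightarrow> g * f \<in> N) \<Longrightarrow> f \<in> N"
  shows "saturated (graded_part N)"
  unfolding saturated_def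
proof (intro allI impI, elim exE)
  fix f k assume k: "\<forall>g\<in>forms k. g * f \<in> graded_part N"
  have "hom_component m f \<in> N" for m
  proof (rule sat)
    fix g :: "'a cpoly" assume g: "g \<in> forms k"
    have "hom_component (k + m) (g * f) \<in> N"
      using k g by (auto simp: graded_part_def)
    then show "g * hom_component m f \<in> N"
      by (simp add: hom_component_form_mult[OF g])
  qed
  then show "f \<in> graded_part N"
    by (simp add: graded_part_def)
qed


section \<open>Finite sets of points\<close>

definition affine_ideal :: "(complex ^ 'n::finite) set \<Rightarrow> 'n cpoly set" where
  "affine_ideal Z = {h. \<forall>v\<in>Z. peval h v = 0}"

lemma is_ideal_affine_ideal: "is_ideal (affine_ideal Z)"
  by (auto simp: is_ideal_def affine_ideal_def)

lemma peval_cmul_eq_sum: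
  assumes "\<And>\<alpha>. \<alpha> \<in> Poly_Mapping.keys h \<Longrightarrow> mdeg \<alpha> \<le> K"
  shows "peval h (c *s v) = (\<Sum>m\<le>K. peval (hom_component m h) v * c ^ m)"
proof -
  have "h = (\<Sum>m\<le>K. hom_component m h)"
  proof (rule poly_mapping_eqI)
    fix \<alpha>
    show "coef h \<alpha> = coef (\<Sum>m\<le>K. hom_component m h) \<alpha>"
      using assms[of \<alpha>] by (auto simp: lookup_sum coef_hom_component in_keys_iff)
  qed
  then have "peval h (c *s v) = peval (\<Sum>m\<le>K. hom_component m h) (c *s v)"
    by simp
  also have "\<dots> = (\<Sum>m\<le>K. peval (hom_component m h) v * c ^ m)"
    by (simp add: peval_form_cmul[OF hom_component_in_forms] mult.commute)
  finally show ?thesis .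
qed

text \<open>Along the line through \<open>v\<close>, a polynomial becomes a polynomial in the scalar
  whose coefficients are the values of its homogeneous components at \<open>v\<close>; it vanishes
  identically only if all of them do.\<close>

lemma vanishing_ideal_eq_graded_part: "vanishing_ideal Z = graded_part (affine_ideal Z)"
proof (intro set_eqI iffI)
  fix h assume "h \<in> graded_part (affine_ideal Z)"
  then have *: "peval (hom_component m h) v = 0" if "v \<in> Z" for m v
    using that by (auto simp: graded_part_def affine_ideal_def)
  have "peval h (c *s v) = 0" if "v \<in> Z" for c v
    by (subst sum_hom_component) (simp add: peval_form_cmul[OF hom_component_in_forms] *[OF that])
  then show "h \<in> vanishing_ideal Z"
    by (simp add: vanishing_ideal_def)
next
  fix h assume h: "h \<in> vanishing_ideal Z"
  \<comment> \<open>The inserted 0 keeps \<open>Max\<close> meaningful when \<open>h\<close> is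
    zero.\<close>
  define K where "K = Max (insert 0 (mdeg ` Poly_Mapping.keys h))"
  have K: "mdeg \<alpha> \<le> K" if "\<alpha> \<in> Poly_Mapping.keys h" for \<alpha>
    using that by (auto simp: K_def)
  have "peval (hom_component m h) v = 0" if "v \<in> Z" for m v
  proof (cases "m \<le> K")
    case True
    have "\<forall>c. (\<Sum>m\<le>K. peval (hom_component m h) v * c ^ m) = 0"
      using h that by (simp add: vanishing_ideal_def peval_cmul_eq_sum[OF K, symmetric])
    with True show ?thesis
      by (simp only: polyfun_eq_0)
  next
    case False
    then have "hom_component m h = 0"
      using K by (intro poly_mapping_eqI) (auto simp: coef_hom_component in_keys_iff)
    then show ?thesis by simp
  qed
  then show "h \<in> graded_part (affine_ideal Z)"
    by (simp add: graded_part_def affine_ideal_def)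
qed

lemma vanishing_ideal_form:
  "h \<in> forms m \<Longrightarrow> h \<in> vanishing_ideal Z \<longleftrightarrow> (\<forall>v\<in>Z. peval h v = 0)"
  by (simp add: vanishing_ideal_eq_graded_part graded_part_form[OF is_ideal_affine_ideal])
    (simp add: affine_ideal_def)

lemma homogeneous_ideal_vanishing_ideal: "homogeneous_ideal (vanishing_ideal Z)"
  unfolding vanishing_ideal_eq_graded_part
  by (rule homogeneous_ideal_graded_part[OF is_ideal_affine_ideal])

lemma saturated_vanishing_ideal:
  assumes "0 \<notin> Z"
  shows "saturated (vanishing_ideal Z)"
  unfolding vanishing_ideal_eq_graded_part
proof (rule saturated_graded_part[OF is_ideal_affine_ideal])
  fix k f assume k: "\<And>g. g \<in> forms k \<Longrightarrow> g * f \<in> affine_ideal Z"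
  have "peval f v = 0" if v: "v \<in> Z" for v
  proof -
    obtain i where i: "v $ i \<noteq> 0"
      using v assms by (metis vec_eq_iff zero_index)
    have "var i ^ k \<in> forms k"
      using forms_power[OF var_in_forms, of i k] by simp
    then have "peval (var i ^ k * f) v = 0"
      using k v unfolding affine_ideal_def by blast
    then show ?thesis using i by simp
  qed
  then show "f \<in> affine_ideal Z"
    by (simp add: affine_ideal_def)
qed

lemma separating_linear_form:
  assumes "w \<noteq> 0" "\<And>c. v \<noteq> c *s w"
  obtains l where "l \<in> forms 1" "peval l w = 0" "peval l v \<noteq> 0"
proof -
  obtain j where j: "w $ j \<noteq> 0"
    using assms(1) by (metis vec_eq_iff zero_index)
  have "v \<noteq> (v $ j / w $ j) *s w" by (rule assms(2))
  then obtain i where i: "v $ i \<noteq> v $ j / w $ j * w $ i"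
    by (auto simp: vec_eq_iff)
  show thesis
  proof
    show "pscale (w $ j) (var i) - pscale (w $ i) (var j) \<in> forms 1"
      by (intro forms_diff forms_pscale var_in_forms)
    show "peval (pscale (w $ j) (var i) - pscale (w $ i) (var j)) v \<noteq> 0"
      using i j by (simp add: field_simps)
  qed simp
qed

lemma exists_interpolating_form:
  assumes Z: "distinct_points r Z" and v: "v \<in> Z" and m: "m \<ge> r"
  obtains s where "s \<in> forms m" "\<And>w. w \<in> Z \<Longrightarrow> peval s w = (if w = v then 1 else 0)"
proof -
  have fin: "finite Z" "card Z = r" "0 \<notin> Z" and np: "\<And>w c. w \<in> Z \<Longrightarrow> w \<noteq> v \<Longrightarrow> v \<noteq> c *s w"
    using Z v by (auto simp: distinct_points_def)
  have "\<exists>l. l \<in> forms 1 \<and> peval l w = 0 \<and> peval l v \<noteq> 0" if "w \<in> Z - {v}" for w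
    using separating_linear_form[of w v] that fin(3) np by (metis Diff_iff singletonI)
  then obtain l where l: "\<And>w. w \<in> Z - {v} \<Longrightarrow> l w \<in> forms 1 \<and> peval (l w) w = 0 \<and> peval (l w) v \<noteq> 0"
    by metis
  obtain i where i: "v $ i \<noteq> 0"
    using v fin(3) by (metis vec_eq_iff zero_index)
  \<comment> \<open>Each factor of the product kills one other point; a coordinate that is nonzero
    at \<open>v\<close> fills the degree up to m.\<close>
  define p where "p = prod l (Z - {v}) * var i ^ (m - (r - 1))"
  have "prod l (Z - {v}) \<in> forms (\<Sum>w\<in>Z - {v}. 1)"
    using l by (intro forms_prod) auto
  moreover have "r \<ge> 1"
    using fin v by (metis One_nat_def Suc_leI card_gt_0_iff empty_iff)
  ultimately have p: "p \<in> forms m"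
    using forms_mult[of "prod l (Z - {v})" "r - 1" "var i ^ (m - (r - 1))" "m - (r - 1)"]
      forms_power[OF var_in_forms, of i "m - (r - 1)"] fin v m by (simp add: p_def)
  have pv: "peval p v \<noteq> 0"
    using l i fin(1) by (simp add: p_def)
  have pw: "peval p w = 0" if "w \<in> Z" "w \<noteq> v" for w
    using l that fin(1) by (auto simp: p_def)
  show thesis
  proof
    show "pscale (1 / peval p v) p \<in> forms m" using p by (rule forms_pscale)
    show "peval (pscale (1 / peval p v) p) w = (if w = v then 1 else 0)" if "w \<in> Z" for w
      using pv pw that by auto
  qed
qed

text \<open>From degree r on, the interpolating forms are a basis modulo the ideal: evaluation at a
  point reads off its coefficient.\<close>

lemma zero_dim_scheme_vanishing_ideal:
  assumes Z: "distinct_points r Z"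
  shows "zero_dim_scheme r (vanishing_ideal Z)"
proof -
  have fin: "finite Z" "card Z = r" "0 \<notin> Z"
    using Z by (auto simp: distinct_points_def)
  have "hilbert_function (vanishing_ideal Z) m = r" if m: "m \<ge> r" for m
  proof -
    have "\<forall>v\<in>Z. \<exists>s. s \<in> forms m \<and> (\<forall>w\<in>Z. peval s w = (if w = v then 1 else 0))"
      using exists_interpolating_form[OF Z _ m] by metis
    then obtain s where s: "\<And>v. v \<in> Z \<Longrightarrow> s v \<in> forms m"
      "\<And>v w. v \<in> Z \<Longrightarrow> w \<in> Z \<Longrightarrow> peval (s v) w = (if w = v then 1 else 0)"
      by metis
    have sum_forms: "(\<Sum>v\<in>Z. pscale (c v) (s v)) \<in> forms m" for c
      using s(1) by (intro forms_sum forms_pscale)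
    have eval: "peval (\<Sum>v\<in>Z. pscale (c v) (s v)) w = c w" if "w \<in> Z" for c w
    proof -
      have "peval (\<Sum>v\<in>Z. pscale (c v) (s v)) w = (\<Sum>v\<in>Z. if v = w then c w else 0)"
        unfolding peval_sum using s(2) that by (intro sum.cong) auto
      then show ?thesis using fin(1) that by simp
    qed
    have "hilbert_function (vanishing_ideal Z) m = card Z"
    proof (rule hilbert_function_eq[OF homogeneous_ideal_vanishing_ideal fin(1)])
      show "indep_mod (vanishing_ideal Z \<inter> forms m) Z s"
        unfolding indep_mod_def
        using eval by (auto simp: vanishing_ideal_form[OF sum_forms])
      show "s ` Z \<subseteq> forms m" using s(1) by auto
      fix f :: "'a cpoly" assume "f \<in> forms m"
      then have "f - (\<Sum>v\<in>Z. pscale (peval f v) (s v)) \<in> forms m"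
        by (intro forms_diff sum_forms)
      then have "f - (\<Sum>v\<in>Z. pscale (peval f v) (s v)) \<in> vanishing_ideal Z"
        using eval by (simp add: vanishing_ideal_form del: peval_sum)
      then show "\<exists>c. f - (\<Sum>v\<in>Z. pscale (c v) (s v)) \<in> vanishing_ideal Z"
        by (rule exI[of _ "peval f"])
    qed
    then show ?thesis using fin(2) by simp
  qed
  then show ?thesis
    unfolding zero_dim_scheme_def
    using homogeneous_ideal_vanishing_ideal saturated_vanishing_ideal[OF fin(3)] by blast
qed

lemma tendsto_form:
  assumes "\<And>k. g k \<in> forms m" "\<And>\<alpha>. (\<lambda>k. coef (g k) \<alpha>) \<longlonglongrightarrow> coef h \<alpha>"
  shows "h \<in> forms m"
proof (rule formsI)
  fix \<alpha> :: "'a \<Rightarrow>\<^sub>0 nat" assume "mdeg \<alpha> \<noteq> m"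
  then have "(\<lambda>k. coef (g k) \<alpha>) = (\<lambda>k. 0)"
    using assms(1) formsD by blast
  then show "coef h \<alpha> = 0"
    using assms(2)[of \<alpha>] by (simp add: LIMSEQ_const_iff)
qed

lemma smoothable_scheme_vanishing_ideal:
  assumes Z: "distinct_points r Z"
  shows "smoothable_scheme r (vanishing_ideal Z)"
proof -
  have "flat_limit (\<lambda>k. vanishing_ideal Z) (vanishing_ideal Z)"
    unfolding flat_limit_def
  proof (intro exI[of _ 0] allI impI set_eqI iffI)
    fix m h assume "h \<in> vanishing_ideal Z \<inter> forms m"
    then show "h \<in> {h. \<exists>g. (\<forall>k. g k \<in> vanishing_ideal Z \<inter> forms m) \<and>
        (\<forall>\<alpha>. (\<lambda>k. coef (g k) \<alpha>) \<longlonglongrightarrow> coef h \<alpha>)}"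
      by (intro CollectI exI[of _ "\<lambda>k. h"]) simp
  next
    fix m h assume "h \<in> {h. \<exists>g. (\<forall>k. g k \<in> vanishing_ideal Z \<inter> forms m) \<and>
        (\<forall>\<alpha>. (\<lambda>k. coef (g k) \<alpha>) \<longlonglongrightarrow> coef h \<alpha>)}"
    then obtain g where g: "\<And>k. g k \<in> vanishing_ideal Z" "\<And>k. g k \<in> forms m"
      "\<And>\<alpha>. (\<lambda>k. coef (g k) \<alpha>) \<longlonglongrightarrow> coef h \<alpha>"
      by auto
    have h: "h \<in> forms m"
      using tendsto_form g(2,3) by blast
    have "peval h v = 0" if v: "v \<in> Z" for v
    proof -
      \<comment> \<open>Summing over all exponents of degree m gives an index set independent of k,
        so convergent coefficients yield convergent values.\<close>
      have "(\<lambda>k. \<Sum>\<alpha> | mdeg \<alpha> = m. coef (g k) \<alpha> * monom_val \<alpha> v)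
          \<longlonglongrightarrow> (\<Sum>\<alpha> | mdeg \<alpha> = m. coef h \<alpha> * monom_val \<alpha> v)"
        by (intro tendsto_intros g(3))
      then have "(\<lambda>k. peval (g k) v) \<longlonglongrightarrow> peval h v"
        by (simp only: peval_eq_sum[OF finite_mdeg_eq keys_forms[OF g(2)]]
            peval_eq_sum[OF finite_mdeg_eq keys_forms[OF h]])
      moreover have "peval (g k) v = 0" for k
        using g(1)[of k] v by (simp add: vanishing_ideal_form[OF g(2)])
      ultimately show ?thesis by (simp add: LIMSEQ_const_iff)
    qed
    then show "h \<in> vanishing_ideal Z \<inter> forms m"
      using h by (simp add: vanishing_ideal_form)
  qed
  then show ?thesis
    unfolding smoothable_scheme_def
    using zero_dim_scheme_vanishing_ideal[OF Z] Z by (intro conjI exI[of _ "\<lambda>_. Z"]) auto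
qed

lemma exists_distinct_representatives:
  fixes Z :: "(complex ^ 'n::finite) set"
  assumes "finite Z" "0 \<notin> Z"
  obtains Y where "distinct_points (card Y) Y" "\<And>v. v \<in> Z \<Longrightarrow> \<exists>w\<in>Y. \<exists>c. v = c *s w"
proof -
  have "\<exists>Y. distinct_points (card Y) Y \<and> (\<forall>v\<in>Z. \<exists>w\<in>Y. \<exists>c. v = c *s w)"
    using assms
  proof (induction Z rule: finite_induct)
    case empty
    show ?case by (intro exI[of _ "{}"]) (simp add: distinct_points_def)
  next
    case (insert v Z)
    then obtain Y where Y: "distinct_points (card Y) Y" "\<forall>v\<in>Z. \<exists>w\<in>Y. \<exists>c. v = c *s w"
      by auto
    show ?case
    proof (cases "\<exists>w\<in>Y. \<exists>c. v = c *s w")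
      case True
      with Y show ?thesis by (intro exI[of _ Y]) auto
    next
      case False
      have "w \<noteq> c *s v" if w: "w \<in> Y" for w c
      proof
        assume wc: "w = c *s v"
        then have "c \<noteq> 0" using w Y(1) by (auto simp: distinct_points_def)
        then have "v = (1 / c) *s w" by (simp add: wc)
        with False w show False by blast
      qed
      then have "distinct_points (card (insert v Y)) (insert v Y)"
        using Y(1) False insert.prems by (auto simp: distinct_points_def)
      moreover have "\<exists>c. v = c *s v" by (rule exI[of _ 1]) simp
      ultimately show ?thesis
        using Y(2) by (intro exI[of _ "insert v Y"]) auto
    qed
  qed
  then show thesis using that by blast
qed

text \<open>Enough distinct points leave no nonzero form of degree d in the ideal, so their span
  contains every form. This is what makes the \<open>LEAST\<close> values in the ranks
  attained.\<close>

lemma exists_smoothable_scheme: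
  fixes F :: "'n::finite cpoly"
  assumes "F \<in> forms d"
  shows "\<exists>r J. smoothable_scheme r J \<and> F \<in> linear_span d J"
proof -
  obtain Z :: "(complex ^ 'n) set" where Z: "finite Z" "0 \<notin> Z"
    "\<And>f. f \<in> forms d \<Longrightarrow> (\<And>v. v \<in> Z \<Longrightarrow> peval f v = 0) \<Longrightarrow> f = 0"
    by (rule exists_points_determining_forms[of d]) blast
  obtain Y where Y: "distinct_points (card Y) Y" "\<And>v. v \<in> Z \<Longrightarrow> \<exists>w\<in>Y. \<exists>c. v = c *s w"
    by (rule exists_distinct_representatives[OF Z(1,2)]) blast
  have zero: "h = 0" if h: "h \<in> vanishing_ideal Y \<inter> forms d" for h
  proof (rule Z(3))
    fix v assume "v \<in> Z"
    then obtain w c where "w \<in> Y" "v = c *s w" using Y(2) by blast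
    then show "peval h v = 0" using h by (auto simp: vanishing_ideal_def)
  qed (use h in auto)
  have "diff_act h F = 0" if "h \<in> vanishing_ideal Y \<inter> forms d" for h
    using zero[OF that] by (simp add: diff_act_def)
  then have "F \<in> linear_span d (vanishing_ideal Y)"
    using assms by (auto simp: linear_span_def)
  then show ?thesis
    using smoothable_scheme_vanishing_ideal[OF Y(1)] by blast
qed


section \<open>Limits of linear systems\<close>

lemma tendsto_det:
  fixes A :: "'b \<Rightarrow> complex ^ 'n ^ 'n"
  assumes "\<And>i j. ((\<lambda>x. A x $ i $ j) \<longlongrightarrow> B $ i $ j) net"
  shows "((\<lambda>x. det (A x)) \<longlongrightarrow> det B) net"
  unfolding det_def by (intro tendsto_intros assms)

text \<open>Cramer's rule writes the solution as quotients of determinants, which converge as the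
  limit determinant is nonzero. The formula holds for all large k, which suffices.\<close>

lemma convergent_solution:
  fixes A :: "nat \<Rightarrow> complex ^ 'n ^ 'n"
  assumes A: "\<And>i j. (\<lambda>k. A k $ i $ j) \<longlonglongrightarrow> B $ i $ j" and B: "det B \<noteq> 0"
    and b: "\<And>k. A k *v x k = b k" "b \<longlonglongrightarrow> c"
  shows "convergent x"
proof -
  let ?C = "\<lambda>A b l. \<chi> i j. if j = l then b $ i else A $ i $ j"
  let ?y = "\<chi> l. det (?C B c l) / det B"
  have det: "(\<lambda>k. det (A k)) \<longlonglongrightarrow> det B"
    by (rule tendsto_det) (rule A)
  have "(\<lambda>k. \<chi> l. det (?C (A k) (b k) l) / det (A k)) \<longlonglongrightarrow> ?y"
  proof (rule vec_tendstoI)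
    fix l
    have "(\<lambda>k. det (?C (A k) (b k) l)) \<longlonglongrightarrow> det (?C B c l)"
      by (rule tendsto_det) (auto intro: A tendsto_vec_nth b(2))
    then show "(\<lambda>k. (\<chi> l. det (?C (A k) (b k) l) / det (A k)) $ l) \<longlonglongrightarrow> ?y $ l"
      by (simp add: tendsto_divide det B)
  qed
  moreover have "\<forall>\<^sub>F k in sequentially. (\<chi> l. det (?C (A k) (b k) l) / det (A k)) = x k"
    using tendsto_imp_eventually_ne[OF det B]
  proof eventually_elim
    case (elim k)
    then show ?case using cramer[OF elim, of "x k" "b k"] b(1) by simp
  qed
  ultimately have "x \<longlonglongrightarrow> ?y"
    by (rule Lim_transform_eventually)
  then show ?thesis by (auto simp: convergent_def)
qed

lemma tendsto_matrix_vector_mult: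
  fixes A :: "nat \<Rightarrow> complex ^ 'n ^ 'm"
  assumes "\<And>i j. (\<lambda>k. A k $ i $ j) \<longlonglongrightarrow> B $ i $ j" "x \<longlonglongrightarrow> y"
  shows "(\<lambda>k. A k *v x k) \<longlonglongrightarrow> B *v y"
  by (rule vec_tendstoI) (auto simp: matrix_vector_mult_def intro!: tendsto_sum tendsto_mult assms tendsto_vec_nth)

lemma det_nonzero_kernel:
  fixes A :: "'a::field ^ 'n ^ 'n"
  assumes "det A \<noteq> 0" "A *v x = 0"
  shows "x = 0"
  using assms by (metis invertible_det_nz invertible_left_inverse matrix_left_invertible_ker)

lemma det_nonzero_solution:
  fixes A :: "'a::field ^ 'n ^ 'n"
  assumes "det A \<noteq> 0"
  shows "\<exists>x. A *v x = b"
  using cramer[OF assms] by blast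


section \<open>Flat limits of points in general position\<close>

text \<open>
  The rows of \<open>U k\<close> are \<open>dim V\<close> points in general position, normalised on the hyperplane \<open>v = 1\<close>. Evaluation
  at these points identifies \<open>T/(v - 1)\<close> modulo their ideal with \<open>complex ^ 'n\<close>, the points themselves being the
  characters; transported along \<open>U k\<close>, the class of \<open>h\<close> is \<open>coords k h\<close>, and \<open>coords k (linear_form w) = w\<close>
  for all \<open>k\<close>. The matrices \<open>H k\<close> and \<open>A k i\<close> control multiplication by \<open>y\<^sub>i\<close> without reference to the possibly
  diverging points.
\<close>

locale point_limit =
  fixes v :: "complex ^ 'n::finite" and U :: "nat \<Rightarrow> complex ^ 'n ^ 'n" and c :: "nat \<Rightarrow> 'n \<Rightarrow> complex"
    and H :: "complex ^ 'n ^ 'n" and A :: "'n \<Rightarrow> complex ^ 'n ^ 'n"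
  assumes unit: "\<And>k t. peval (linear_form v) (U k $ t) = 1"
    and det_U: "\<And>k. det (U k) \<noteq> 0"
    and det_H: "det H \<noteq> 0"
    and H: "\<And>i j. (\<lambda>k. \<Sum>t\<in>UNIV. c k t * U k $ t $ i * U k $ t $ j) \<longlonglongrightarrow> H $ i $ j"
    and A: "\<And>l i j. (\<lambda>k. \<Sum>t\<in>UNIV. c k t * U k $ t $ l * U k $ t $ i * U k $ t $ j) \<longlonglongrightarrow> A l $ i $ j"
begin

text \<open>The coefficients of the unique linear form with the same values as \<open>h\<close> at
  the rows of \<open>U k\<close>; uniqueness comes from the invertibility of
  \<open>U k\<close>.\<close>

definition coords :: "nat \<Rightarrow> 'n cpoly \<Rightarrow> complex ^ 'n" where
  "coords k h = (SOME x. U k *v x = (\<chi> t. peval h (U k $ t)))"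

lemma U_coords: "U k *v coords k h = (\<chi> t. peval h (U k $ t))"
  unfolding coords_def by (rule someI_ex) (rule det_nonzero_solution[OF det_U])

lemma peval_point: "(\<Sum>j\<in>UNIV. U k $ t $ j * coords k h $ j) = peval h (U k $ t)"
  using U_coords[of k h] by (simp add: matrix_vector_mult_def vec_eq_iff)

lemma coords_eqI:
  assumes "\<And>t. (\<Sum>j\<in>UNIV. U k $ t $ j * x $ j) = peval h (U k $ t)"
  shows "coords k h = x"
proof -
  have "U k *v (coords k h - x) = 0"
    using U_coords[of k h] assms
    by (simp add: matrix_vector_mult_diff_distrib) (simp add: matrix_vector_mult_def vec_eq_iff)
  then have "coords k h - x = 0" by (rule det_nonzero_kernel[OF det_U])
  then show ?thesis by simp
qed

lemma coords_eq_0_iff: "coords k h = 0 \<longleftrightarrow> (\<forall>t. peval h (U k $ t) = 0)"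
  using peval_point[of k _ h] coords_eqI[of k 0 h] by auto

lemma coords_add: "coords k (f + g) = coords k f + coords k g"
  by (rule coords_eqI) (simp add: distrib_left sum.distrib peval_point)

lemma coords_pscale: "coords k (pscale a f) = a *s coords k f"
proof (rule coords_eqI)
  fix t
  have "(\<Sum>j\<in>UNIV. U k $ t $ j * (a *s coords k f) $ j) = a * (\<Sum>j\<in>UNIV. U k $ t $ j * coords k f $ j)"
    by (simp add: sum_distrib_left mult.left_commute)
  then show "(\<Sum>j\<in>UNIV. U k $ t $ j * (a *s coords k f) $ j) = peval (pscale a f) (U k $ t)"
    by (simp add: peval_point)
qed

lemma coords_linear_form: "coords k (linear_form w) = w"
  by (rule coords_eqI) (simp add: peval_linear_form mult.commute)

lemma coords_unit_mult: "coords k (linear_form v ^ j * h) = coords k h"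
  by (rule coords_eqI) (simp add: peval_point unit)

lemma coords_one: "coords k 1 = v"
  using coords_unit_mult[of k 1 1] by (simp add: coords_linear_form)

section \<open>Multiplication by a variable and its limit\<close>

definition H_seq :: "nat \<Rightarrow> complex ^ 'n ^ 'n" where
  "H_seq k = (\<chi> i j. \<Sum>t\<in>UNIV. c k t * U k $ t $ i * U k $ t $ j)"

definition A_seq :: "nat \<Rightarrow> 'n \<Rightarrow> complex ^ 'n ^ 'n" where
  "A_seq k l = (\<chi> i j. \<Sum>t\<in>UNIV. c k t * U k $ t $ l * U k $ t $ i * U k $ t $ j)"

text \<open>Entry i of both sides is the weighted sum over the points of the values of
  \<open>var i * var l * h\<close>. This determines multiplication by a variable from the converging
  moments wherever \<open>H_seq k\<close> is invertible.\<close>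

lemma H_coords_var_mult: "H_seq k *v coords k (var l * h) = A_seq k l *v coords k h"
proof -
  have key: "(\<Sum>j\<in>UNIV. (\<Sum>t\<in>UNIV. a t * U k $ t $ j) * coords k f $ j)
      = (\<Sum>t\<in>UNIV. a t * peval f (U k $ t))" for a f
  proof -
    have "(\<Sum>j\<in>UNIV. (\<Sum>t\<in>UNIV. a t * U k $ t $ j) * coords k f $ j)
        = (\<Sum>t\<in>UNIV. \<Sum>j\<in>UNIV. a t * (U k $ t $ j * coords k f $ j))"
      by (subst sum.swap) (simp add: sum_distrib_right mult.assoc)
    then show ?thesis
      by (simp add: sum_distrib_left[symmetric] peval_point)
  qed
  have "(H_seq k *v coords k (var l * h)) $ i = (A_seq k l *v coords k h) $ i" for i
    by (simp add: matrix_vector_mult_def H_seq_def A_seq_def key) (simp add: ac_simps)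
  then show ?thesis
    by (simp add: vec_eq_iff)
qed

lemma H_seq_tendsto: "(\<lambda>k. H_seq k $ i $ j) \<longlonglongrightarrow> H $ i $ j"
  using H[of i j] by (simp add: H_seq_def)

lemma A_seq_tendsto: "(\<lambda>k. A_seq k l $ i $ j) \<longlonglongrightarrow> A l $ i $ j"
  using A[of l i j] by (simp add: A_seq_def)

lemma tendsto_cmul:
  assumes "(x :: nat \<Rightarrow> complex ^ 'n) \<longlonglongrightarrow> y" "a \<longlonglongrightarrow> b"
  shows "(\<lambda>k. a k *s x k) \<longlonglongrightarrow> b *s y"
  using assms by (intro vec_tendstoI) (auto intro!: tendsto_mult tendsto_vec_nth)

text \<open>Constants have constant coordinates, since the unit of each algebra is \<open>v\<close>.
  Each further variable factor amounts to solving a linear system whose matrix has a nonsingular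
  limit.\<close>

lemma convergent_coords: "convergent (\<lambda>k. coords k h)"
proof (induction h rule: poly_var_induct)
  case (const a)
  have "coords k (Poly_Mapping.single 0 a) = a *s v" for k
    using coords_pscale[of k a 1] by (simp add: pscale_def coords_one)
  then show ?case by (simp add: convergent_const)
next
  case (var p i)
  then obtain L where "(\<lambda>k. coords k p) \<longlonglongrightarrow> L"
    by (auto simp: convergent_def)
  then have "(\<lambda>k. A_seq k i *v coords k p) \<longlonglongrightarrow> A i *v L"
    by (intro tendsto_matrix_vector_mult A_seq_tendsto)
  then show ?case
    by (intro convergent_solution[OF H_seq_tendsto det_H H_coords_var_mult])
next
  case (add p q)
  then show ?case
    by (simp add: coords_add convergent_add)
qed

definition coords_lim :: "'n cpoly \<Rightarrow> complex ^ 'n" where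
  "coords_lim h = lim (\<lambda>k. coords k h)"

lemma coords_tendsto: "(\<lambda>k. coords k h) \<longlonglongrightarrow> coords_lim h"
  using convergent_coords unfolding coords_lim_def by (rule convergent_LIMSEQ_iff[THEN iffD1])

lemma coords_lim_eqI: "(\<lambda>k. coords k h) \<longlonglongrightarrow> x \<Longrightarrow> coords_lim h = x"
  using coords_tendsto by (rule LIMSEQ_unique)

lemma coords_lim_add: "coords_lim (f + g) = coords_lim f + coords_lim g"
  by (rule coords_lim_eqI) (simp add: coords_add tendsto_add coords_tendsto)

lemma coords_lim_pscale: "coords_lim (pscale a f) = a *s coords_lim f"
  by (rule coords_lim_eqI) (simp add: coords_pscale tendsto_cmul coords_tendsto)

lemma coords_lim_diff: "coords_lim (f - g) = coords_lim f - coords_lim g"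
  using coords_lim_add[of "f - g" g] by simp

lemma coords_lim_zero [simp]: "coords_lim 0 = 0"
  using coords_lim_add[of 0 0] by simp

lemma coords_lim_linear_form: "coords_lim (linear_form v ^ j * linear_form w) = w"
  by (rule coords_lim_eqI) (simp add: coords_unit_mult coords_linear_form)

lemma coords_lim_unit_mult: "coords_lim (linear_form v ^ j * h) = coords_lim h"
  by (rule coords_lim_eqI) (simp add: coords_unit_mult coords_tendsto)

text \<open>The moment identity passes to the limit, where \<open>H\<close> can be
  cancelled.\<close>

lemma coords_lim_var_mult:
  assumes "coords_lim h = 0"
  shows "coords_lim (var i * h) = 0"
proof -
  have "(\<lambda>k. H_seq k *v coords k (var i * h)) \<longlonglongrightarrow> H *v coords_lim (var i * h)"
    by (intro tendsto_matrix_vector_mult H_seq_tendsto coords_tendsto)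
  moreover have "(\<lambda>k. A_seq k i *v coords k h) \<longlonglongrightarrow> A i *v coords_lim h"
    by (intro tendsto_matrix_vector_mult A_seq_tendsto coords_tendsto)
  ultimately have "H *v coords_lim (var i * h) = A i *v coords_lim h"
    unfolding H_coords_var_mult by (rule LIMSEQ_unique)
  then show ?thesis
    using assms det_nonzero_kernel[OF det_H] by simp
qed

section \<open>The limit ideal and its scheme\<close>

definition limit_kernel :: "'n cpoly set" where
  "limit_kernel = {h. coords_lim h = 0}"

lemma is_ideal_limit_kernel: "is_ideal limit_kernel"
proof -
  have "coords_lim (g * h) = 0" if "coords_lim h = 0" for g h
  proof (induction g rule: poly_var_induct)
    case (const a)
    show ?case using coords_lim_pscale[of a h] that by (simp add: pscale_def)
  next
    case (var p i)
    then show ?case by (simp add: mult.assoc coords_lim_var_mult)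
  next
    case (add p q)
    then show ?case by (simp add: distrib_right coords_lim_add)
  qed
  then show ?thesis
    by (auto simp: is_ideal_def limit_kernel_def coords_lim_add)
qed

definition limit_ideal :: "'n cpoly set" where
  "limit_ideal = graded_part limit_kernel"

lemma limit_ideal_form: "h \<in> forms m \<Longrightarrow> h \<in> limit_ideal \<longleftrightarrow> coords_lim h = 0"
  by (simp add: limit_ideal_def graded_part_form[OF is_ideal_limit_kernel]) (simp add: limit_kernel_def)

lemma sum_section: "(\<Sum>i\<in>UNIV. pscale (x $ i) (linear_form v ^ j * var i)) = linear_form v ^ j * linear_form x"
  by (simp add: linear_form_def[of x] sum_distrib_left pscale_mult_right)

lemma section_in_forms: "m \<ge> 1 \<Longrightarrow> linear_form v ^ (m - 1) * linear_form x \<in> forms m"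
  using forms_mult[OF linear_form_power_in_forms linear_form_in_forms, of v "m - 1" x] by simp

text \<open>In each positive degree the limit coordinates map forms onto
  \<open>complex ^ 'n\<close>, with the padded linear forms as a section and the limit ideal as
  kernel.\<close>

lemma hilbert_function_limit_ideal:
  assumes m: "m \<ge> 1"
  shows "hilbert_function limit_ideal m = CARD('n)"
proof (rule hilbert_function_eq)
  let ?g = "\<lambda>i. linear_form v ^ (m - 1) * var i"
  show "homogeneous_ideal limit_ideal"
    unfolding limit_ideal_def by (rule homogeneous_ideal_graded_part[OF is_ideal_limit_kernel])
  show "?g ` UNIV \<subseteq> forms m"
    using section_in_forms[OF m, of "axis _ 1"] by (auto simp: linear_form_axis)
  show "indep_mod (limit_ideal \<inter> forms m) UNIV ?g"
    unfolding indep_mod_def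
  proof (intro allI impI ballI)
    fix a :: "'n \<Rightarrow> complex" and i
    assume a: "(\<Sum>i\<in>UNIV. pscale (a i) (?g i)) \<in> limit_ideal \<inter> forms m"
    have "(\<Sum>i\<in>UNIV. pscale (a i) (?g i)) = linear_form v ^ (m - 1) * linear_form (\<chi> i. a i)"
      using sum_section[of "\<chi> i. a i" "m - 1"] by simp
    with a have "linear_form v ^ (m - 1) * linear_form (\<chi> i. a i) \<in> limit_ideal" by simp
    then have "(\<chi> i. a i) = 0"
      by (simp add: limit_ideal_form[OF section_in_forms[OF m]] coords_lim_linear_form del: One_nat_def)
    then show "a i = 0" by (simp add: vec_eq_iff)
  qed
  fix f :: "'n cpoly" assume f: "f \<in> forms m"
  let ?h = "f - linear_form v ^ (m - 1) * linear_form (coords_lim f)"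
  have "?h \<in> forms m"
    by (intro forms_diff f section_in_forms m)
  then have "?h \<in> limit_ideal"
    by (simp add: limit_ideal_form coords_lim_diff coords_lim_linear_form)
  then have "f - (\<Sum>i\<in>UNIV. pscale (coords_lim f $ i) (?g i)) \<in> limit_ideal"
    by (simp add: sum_section)
  then show "\<exists>a. f - (\<Sum>i\<in>UNIV. pscale (a i) (?g i)) \<in> limit_ideal"
    by (rule exI[of _ "\<lambda>i. coords_lim f $ i"])
qed simp

lemma zero_dim_scheme_limit_ideal: "zero_dim_scheme CARD('n) limit_ideal"
proof -
  have "saturated limit_ideal"
    unfolding limit_ideal_def
  proof (rule saturated_graded_part[OF is_ideal_limit_kernel])
    fix k f assume "\<And>g. g \<in> forms k \<Longrightarrow> g * f \<in> limit_kernel"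
    \<comment> \<open>Multiplication by powers of this linear form leaves the limit coordinates
      unchanged.\<close>
    from this[OF linear_form_power_in_forms, of v] show "f \<in> limit_kernel"
      by (simp add: limit_kernel_def coords_lim_unit_mult)
  qed
  moreover have "homogeneous_ideal limit_ideal"
    unfolding limit_ideal_def by (rule homogeneous_ideal_graded_part[OF is_ideal_limit_kernel])
  ultimately show ?thesis
    unfolding zero_dim_scheme_def using hilbert_function_limit_ideal by blast
qed

lemma distinct_points_rows: "distinct_points CARD('n) (range (\<lambda>t. U k $ t))"
proof -
  have inj: "s = t" if "U k $ s = U k $ t" for s t
    using det_identical_rows[of s t "U k"] det_U[of k] that by (auto simp: row_def)
  have unit1: "peval (linear_form v) (a *s U k $ t) = a" for a t
    using peval_form_cmul[OF linear_form_in_forms, of v a "U k $ t"] by (simp add: unit)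
  have "card (range (\<lambda>t. U k $ t)) = CARD('n)"
    using inj by (intro card_image injI) auto
  moreover have "0 \<notin> range (\<lambda>t. U k $ t)"
  proof
    assume "0 \<in> range (\<lambda>t. U k $ t)"
    then obtain t where "U k $ t = 0" by (metis rangeE)
    with unit[of k t] show False by (simp add: peval_linear_form)
  qed
  moreover have "U k $ s \<noteq> a *s U k $ t" if "U k $ s \<noteq> U k $ t" for s t a
  proof
    assume "U k $ s = a *s U k $ t"
    then have "a = 1" using unit1[of a t] unit[of k s] by simp
    with \<open>U k $ s = a *s U k $ t\<close> that show False by simp
  qed
  ultimately show ?thesis
    by (auto simp: distinct_points_def)
qed

lemma vanishing_ideal_rows:
  "h \<in> forms m \<Longrightarrow> h \<in> vanishing_ideal (range (\<lambda>t. U k $ t)) \<longleftrightarrow> coords k h = 0"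
  by (simp add: vanishing_ideal_form coords_eq_0_iff)

lemma coords_sum: "coords k (sum f S) = (\<Sum>x\<in>S. coords k (f x))"
proof (induction S rule: infinite_finite_induct)
  case (infinite S)
  then show ?case using coords_eq_0_iff[of k 0] by simp
next
  case empty
  then show ?case using coords_eq_0_iff[of k 0] by simp
qed (simp add: coords_add)

lemma coords_lim_sum: "coords_lim (sum f S) = (\<Sum>x\<in>S. coords_lim (f x))"
  by (rule coords_lim_eqI) (simp add: coords_sum tendsto_sum coords_tendsto)

text \<open>Subtracting from \<open>h\<close> the padded linear form of its k-th coordinates puts it
  into the k-th ideal, and the correction tends to zero when \<open>coords_lim h\<close> does
  vanish. Conversely, coefficients and coordinates of monomials both converge, so vanishing
  coordinates pass to the limit.\<close>

lemma flat_limit_limit_ideal: "flat_limit (\<lambda>k. vanishing_ideal (range (\<lambda>t. U k $ t))) limit_ideal"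
  unfolding flat_limit_def
proof (intro exI[of _ 1] allI impI set_eqI iffI)
  fix m h assume m: "(1::nat) \<le> m" and h: "h \<in> limit_ideal \<inter> forms m"
  define g where "g k = h - linear_form v ^ (m - 1) * linear_form (coords k h)" for k
  have g: "g k \<in> forms m" for k
    unfolding g_def using h by (intro forms_diff section_in_forms m) auto
  have "coords k (g k) = 0" for k
  proof -
    have "coords k (g k) + coords k (linear_form v ^ (m - 1) * linear_form (coords k h)) = coords k h"
      unfolding coords_add[symmetric] by (simp add: g_def)
    then show ?thesis by (simp add: coords_unit_mult coords_linear_form)
  qed
  then have "g k \<in> vanishing_ideal (range (\<lambda>t. U k $ t))" for k
    by (simp add: vanishing_ideal_rows[OF g])
  moreover have "(\<lambda>k. coef (g k) \<alpha>) \<longlonglongrightarrow> coef h \<alpha>" for \<alpha>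
  proof -
    have "coords_lim h = 0"
      using h limit_ideal_form by blast
    then have "(\<lambda>k. coords k h $ i) \<longlonglongrightarrow> 0" for i
      using tendsto_vec_nth[OF coords_tendsto[of h], of i] by simp
    then have "(\<lambda>k. coef h \<alpha> - (\<Sum>i\<in>UNIV. coords k h $ i * coef (linear_form v ^ (m - 1) * var i) \<alpha>))
        \<longlonglongrightarrow> coef h \<alpha> - (\<Sum>i\<in>UNIV. 0 * coef (linear_form v ^ (m - 1) * var i) \<alpha>)"
      by (intro tendsto_intros)
    then show ?thesis
      by (simp add: g_def lookup_minus sum_section[symmetric] lookup_sum)
  qed
  ultimately show "h \<in> {h. \<exists>g. (\<forall>k. g k \<in> vanishing_ideal (range (\<lambda>t. U k $ t)) \<inter> forms m) \<and>
      (\<forall>\<alpha>. (\<lambda>k. coef (g k) \<alpha>) \<longlonglongrightarrow> coef h \<alpha>)}"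
    using g by blast
next
  fix m h assume "h \<in> {h. \<exists>g. (\<forall>k. g k \<in> vanishing_ideal (range (\<lambda>t. U k $ t)) \<inter> forms m) \<and>
      (\<forall>\<alpha>. (\<lambda>k. coef (g k) \<alpha>) \<longlonglongrightarrow> coef h \<alpha>)}"
  then obtain g where g: "\<And>k. g k \<in> vanishing_ideal (range (\<lambda>t. U k $ t))" "\<And>k. g k \<in> forms m"
    "\<And>\<alpha>. (\<lambda>k. coef (g k) \<alpha>) \<longlonglongrightarrow> coef h \<alpha>"
    by auto
  have h: "h \<in> forms m"
    using tendsto_form g(2,3) by blast
  let ?E = "{\<alpha>::'n \<Rightarrow>\<^sub>0 nat. mdeg \<alpha> = m}"
  have "(\<lambda>k. \<Sum>\<alpha>\<in>?E. coef (g k) \<alpha> *s coords k (monom \<alpha>)) \<longlonglongrightarrow> (\<Sum>\<alpha>\<in>?E. coef h \<alpha> *s coords_lim (monom \<alpha>))"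
    by (intro tendsto_sum tendsto_cmul coords_tendsto g(3))
  moreover have "(\<Sum>\<alpha>\<in>?E. coef (g k) \<alpha> *s coords k (monom \<alpha>)) = 0" for k
  proof -
    have "coords k (g k) = (\<Sum>\<alpha>\<in>?E. coef (g k) \<alpha> *s coords k (monom \<alpha>))"
      by (subst poly_eq_sum[OF finite_mdeg_eq keys_forms[OF g(2)]]) (simp add: coords_sum coords_pscale)
    then show ?thesis
      using g(1)[of k] vanishing_ideal_rows[OF g(2)] by simp
  qed
  moreover have "(\<Sum>\<alpha>\<in>?E. coef h \<alpha> *s coords_lim (monom \<alpha>)) = coords_lim h"
    by (subst (2) poly_eq_sum[OF finite_mdeg_eq keys_forms[OF h]]) (simp add: coords_lim_sum coords_lim_pscale)
  ultimately have "coords_lim h = 0"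
    by (simp add: LIMSEQ_const_iff)
  then show "h \<in> limit_ideal \<inter> forms m"
    using h limit_ideal_form by blast
qed

lemma smoothable_scheme_limit_ideal: "smoothable_scheme CARD('n) limit_ideal"
  unfolding smoothable_scheme_def
  using zero_dim_scheme_limit_ideal distinct_points_rows flat_limit_limit_ideal
  by (intro conjI exI[of _ "\<lambda>k. range (\<lambda>t. U k $ t)"]) auto

end


section \<open>Forms of minimal border rank with nonvanishing Hessian\<close>

lemma apair_tendsto:
  assumes "\<And>\<alpha>. (\<lambda>k. coef (G k) \<alpha>) \<longlonglongrightarrow> coef F \<alpha>"
  shows "(\<lambda>k. apair h (G k)) \<longlonglongrightarrow> apair h F"
  unfolding apair_eq_sum_keys by (intro tendsto_intros assms)

text \<open>Indexing the summands by \<open>'n\<close> makes the points rows of a square matrix; the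
  factorial from evaluation is absorbed into the weights.\<close>

lemma apair_secant_spans:
  fixes G :: "'n::finite cpoly"
  assumes "G \<in> secant_spans CARD('n) d"
  shows "\<exists>(a :: 'n \<Rightarrow> complex) x. \<forall>h\<in>forms d. apair h G = (\<Sum>t\<in>UNIV. a t * peval h (x t))"
proof -
  obtain c P where G: "G = (\<Sum>i<CARD('n). pscale (c i) (P i))" "\<And>i. i < CARD('n) \<Longrightarrow> P i \<in> veronese d"
    using assms by (auto simp: secant_spans_def)
  have "\<forall>i<CARD('n). \<exists>p. P i = linear_form p ^ d"
    using G(2) by (auto simp: veronese_def)
  then obtain p where p: "\<And>i. i < CARD('n) \<Longrightarrow> P i = linear_form (p i) ^ d"
    by metis
  obtain b :: "'n \<Rightarrow> nat" where b: "bij_betw b UNIV {..<CARD('n)}"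
    using ex_bij_betw_finite_nat[of "UNIV :: 'n set"] by (auto simp: atLeast0LessThan)
  show ?thesis
  proof (intro exI ballI)
    fix h :: "'n cpoly" assume h: "h \<in> forms d"
    have "apair h G = (\<Sum>i<CARD('n). c i * (fact d * peval h (p i)))"
      unfolding G(1) apair_sum_right apair_pscale_right
      by (rule sum.cong) (auto simp: p apair_linear_form_power[OF h])
    also have "\<dots> = (\<Sum>t\<in>UNIV. c (b t) * (fact d * peval h (p (b t))))"
      by (rule sum.reindex_bij_betw[OF b, symmetric])
    finally show "apair h G = (\<Sum>t\<in>UNIV. (c (b t) * fact d) * peval h (p (b t)))"
      by (simp add: mult.assoc)
  qed
qed

text \<open>
  \<open>Hess G (v)\<close> factors as \<open>X\<^sup>T D X\<close>, where the rows of \<open>X\<close> are the points and \<open>D\<close> is diagonal; hence the points are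
  independent and lie off the hyperplane \<open>v = 0\<close>.
\<close>

lemma secant_points_in_general_position:
  fixes G :: "'n::finite cpoly"
  assumes d: "d \<ge> 3" and G: "G \<in> secant_spans CARD('n) d" and det: "det (hessian_at G v) \<noteq> 0"
  shows "\<exists>(U :: complex ^ 'n ^ 'n) c. (\<forall>t. peval (linear_form v) (U $ t) = 1) \<and> det U \<noteq> 0 \<and>
    (\<forall>h\<in>forms d. apair h G = (\<Sum>t\<in>UNIV. c t * peval h (U $ t)))"
proof -
  obtain a :: "'n \<Rightarrow> complex" and x :: "'n \<Rightarrow> complex ^ 'n"
    where ax: "\<And>h. h \<in> forms d \<Longrightarrow> apair h G = (\<Sum>t\<in>UNIV. a t * peval h (x t))"
    using apair_secant_spans[OF G] by blast
  define s where "s t = peval (linear_form v) (x t)" for t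
  define X where "X = (\<chi> t. x t)"
  define D where "D = (\<chi> i j. if i = j then a i * s i ^ (d - 2) / fact (d - 2) else (0::complex))"
  have G2: "G \<in> forms (Suc (Suc (d - 2)))"
    using G secant_spans_subset_forms[of "CARD('n)" d] d by (auto simp: numeral_2_eq_2 Suc_diff_Suc)
  have "hessian_at G v $ i $ j = (\<Sum>t\<in>UNIV. x t $ i * (a t * s t ^ (d - 2) / fact (d - 2) * x t $ j))" for i j
  proof -
    have "var i * var j * linear_form v ^ (d - 2) \<in> forms (1 + 1 + (d - 2))"
      by (intro forms_mult var_in_forms linear_form_power_in_forms)
    moreover have "1 + 1 + (d - 2) = d" using d by simp
    ultimately have "fact (d - 2) * hessian_at G v $ i $ j
        = (\<Sum>t\<in>UNIV. a t * (x t $ i * x t $ j * s t ^ (d - 2)))"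
      using ax[of "var i * var j * linear_form v ^ (d - 2)"] by (simp add: apair_var_var_power[OF G2] s_def)
    then have "hessian_at G v $ i $ j
        = (\<Sum>t\<in>UNIV. a t * (x t $ i * x t $ j * s t ^ (d - 2))) / fact (d - 2)"
      by (simp add: field_simps)
    then show ?thesis by (simp add: sum_divide_distrib ac_simps)
  qed
  moreover have "(\<Sum>l\<in>UNIV. D $ t $ l * x l $ j) = a t * s t ^ (d - 2) / fact (d - 2) * x t $ j" for t j
  proof -
    have "(\<Sum>l\<in>UNIV. D $ t $ l * x l $ j)
        = (\<Sum>l\<in>UNIV. if l = t then a t * s t ^ (d - 2) / fact (d - 2) * x t $ j else 0)"
      by (rule sum.cong) (auto simp: D_def)
    then show ?thesis by simp
  qed
  ultimately have "hessian_at G v = transpose X ** (D ** X)"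
    by (simp add: vec_eq_iff matrix_matrix_mult_def transpose_def X_def)
  then have "det X \<noteq> 0" "det D \<noteq> 0"
    using det by (auto simp: det_mul det_transpose)
  moreover have "det D = (\<Prod>i\<in>UNIV. a i * s i ^ (d - 2) / fact (d - 2))"
    by (subst det_diagonal) (simp_all add: D_def)
  \<comment> \<open>The exponent d - 2 is positive, so a nonzero diagonal entry forces both the
    weight and \<open>s t\<close> to be nonzero.\<close>
  ultimately have s: "s t \<noteq> 0" for t
    using d by (auto simp: zero_power)
  define U where "U = (\<chi> t. (1 / s t) *s x t)"
  have x_U: "x t = s t *s (U $ t)" for t
    using s[of t] by (simp add: U_def)
  have "det U = (\<Prod>t\<in>UNIV. 1 / s t) * det X"
    unfolding U_def X_def by (rule det_rows_mul)
  then have "det U \<noteq> 0"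
    using s \<open>det X \<noteq> 0\<close> by simp
  moreover have "peval (linear_form v) (U $ t) = 1" for t
    using s[of t] peval_form_cmul[OF linear_form_in_forms, of v "1 / s t" "x t"] by (simp add: U_def s_def)
  moreover have "apair h G = (\<Sum>t\<in>UNIV. (a t * s t ^ d) * peval h (U $ t))" if "h \<in> forms d" for h
    unfolding ax[OF that] by (subst x_U) (simp add: peval_form_cmul[OF that] mult.assoc)
  ultimately show ?thesis
    by (intro exI[of _ U] exI[of _ "\<lambda>t. a t * s t ^ d"]) simp
qed

lemma smoothable_scheme_of_Hess_nonzero:
  fixes F :: "'n::finite cpoly"
  assumes d: "d \<ge> 3" and F: "F \<in> secant_variety CARD('n) d" and Hess: "Hess F \<noteq> 0"
  shows "\<exists>J. smoothable_scheme CARD('n) J \<and> F \<in> linear_span d J"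
proof -
  have F_forms: "F \<in> forms d" using F by (simp add: secant_variety_def)
  obtain v where "peval (Hess F) v \<noteq> 0"
    using exists_peval_nonzero[OF Hess] by blast
  then have det: "det (hessian_at F v) \<noteq> 0"
    by (simp add: peval_Hess)
  obtain G0 where G0: "\<And>k::nat. G0 k \<in> secant_spans CARD('n) d" "\<And>\<alpha>. (\<lambda>k. coef (G0 k) \<alpha>) \<longlonglongrightarrow> coef F \<alpha>"
    using secant_variety_sequence[OF F] by blast
  have hess: "hessian_at P v $ i $ j = apair (var i * var j * linear_form v ^ (d - 2)) P / fact (d - 2)"
    if "P \<in> forms d" for P :: "'n cpoly" and i j
  proof -
    have "P \<in> forms (Suc (Suc (d - 2)))" using that d by (simp add: numeral_2_eq_2 Suc_diff_Suc)
    then show ?thesis by (simp add: apair_var_var_power)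
  qed
  have G0_forms: "G0 k \<in> forms d" for k
    using G0(1) secant_spans_subset_forms by blast
  have "(\<lambda>k. hessian_at (G0 k) v $ i $ j) \<longlonglongrightarrow> hessian_at F v $ i $ j" for i j
    unfolding hess[OF F_forms] hess[OF G0_forms] by (intro tendsto_intros apair_tendsto G0(2)) simp
  then have "(\<lambda>k. det (hessian_at (G0 k) v)) \<longlonglongrightarrow> det (hessian_at F v)"
    by (rule tendsto_det)
  then have "\<forall>\<^sub>F k in sequentially. det (hessian_at (G0 k) v) \<noteq> 0"
    using det by (rule tendsto_imp_eventually_ne)
  then obtain k0 where k0: "\<And>k. k \<ge> k0 \<Longrightarrow> det (hessian_at (G0 k) v) \<noteq> 0"
    by (auto simp: eventually_sequentially)
  \<comment> \<open>The first terms are dropped because the Hessian determinants at \<open>v\<close>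
    are nonzero only from some index on.\<close>
  define G where "G k = G0 (k + k0)" for k
  have G_lim: "(\<lambda>k. coef (G k) \<alpha>) \<longlonglongrightarrow> coef F \<alpha>" for \<alpha>
    unfolding G_def using G0(2) by (rule LIMSEQ_ignore_initial_segment)
  have "\<exists>(U :: complex ^ 'n ^ 'n) c. (\<forall>t. peval (linear_form v) (U $ t) = 1) \<and> det U \<noteq> 0 \<and>
      (\<forall>h\<in>forms d. apair h (G k) = (\<Sum>t\<in>UNIV. c t * peval h (U $ t)))" for k
    unfolding G_def by (rule secant_points_in_general_position[OF d G0(1) k0]) simp
  then obtain U :: "nat \<Rightarrow> complex ^ 'n ^ 'n" and c where
    U: "\<And>k t. peval (linear_form v) (U k $ t) = 1" "\<And>k. det (U k) \<noteq> 0" and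
    G: "\<And>k h. h \<in> forms d \<Longrightarrow> apair h (G k) = (\<Sum>t\<in>UNIV. c k t * peval h (U k $ t))"
    by metis
  \<comment> \<open>Third order moments, padded to degree d. Dividing by
    \<open>fact (d - 2)\<close>, here and in the weights, makes the second order moments converge to
    exactly \<open>hessian_at F v\<close>.\<close>
  define A where "A l = (\<chi> i j. apair (var l * var i * var j * linear_form v ^ (d - 3)) F / fact (d - 2))" for l
  have lim: "(\<lambda>k. \<Sum>t\<in>UNIV. c k t / fact (d - 2) * peval h (U k $ t)) \<longlonglongrightarrow> apair h F / fact (d - 2)"
    if "h \<in> forms d" for h
  proof -
    have "(\<lambda>k. apair h (G k) / fact (d - 2)) \<longlonglongrightarrow> apair h F / fact (d - 2)"
      by (intro tendsto_intros apair_tendsto G_lim) simp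
    then show ?thesis by (simp add: G[OF that] sum_divide_distrib)
  qed
  interpret point_limit v U "\<lambda>k t. c k t / fact (d - 2)" "hessian_at F v" A
  proof
    fix i j
    have "var i * var j * linear_form v ^ (d - 2) \<in> forms (1 + 1 + (d - 2))"
      by (intro forms_mult var_in_forms linear_form_power_in_forms)
    moreover have "1 + 1 + (d - 2) = d" using d by simp
    ultimately have "var i * var j * linear_form v ^ (d - 2) \<in> forms d" by simp
    from lim[OF this]
    show "(\<lambda>k. \<Sum>t\<in>UNIV. c k t / fact (d - 2) * U k $ t $ i * U k $ t $ j) \<longlonglongrightarrow> hessian_at F v $ i $ j"
      by (simp add: U(1) hess[OF F_forms] mult.assoc)
    fix l
    have "var l * var i * var j * linear_form v ^ (d - 3) \<in> forms (1 + 1 + 1 + (d - 3))"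
      by (intro forms_mult var_in_forms linear_form_power_in_forms)
    moreover have "1 + 1 + 1 + (d - 3) = d" using d by simp
    ultimately have "var l * var i * var j * linear_form v ^ (d - 3) \<in> forms d" by simp
    from lim[OF this]
    show "(\<lambda>k. \<Sum>t\<in>UNIV. c k t / fact (d - 2) * U k $ t $ l * U k $ t $ i * U k $ t $ j) \<longlonglongrightarrow> A l $ i $ j"
      by (simp add: U(1) A_def mult.assoc)
  qed (use U det in auto)
  have "diff_act h F = 0" if h: "h \<in> limit_ideal \<inter> forms d" for h
  proof -
    \<comment> \<open>On the normalised points this form of degree d takes the value of the j-th
      coordinate. Replacing \<open>h\<close> by its coordinates then expresses the pairing through
      convergent quantities only, although the weights \<open>c k t\<close> themselves may
      diverge.\<close>
    let ?e = "\<lambda>j. var j * linear_form v ^ (d - 1)"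
    have e: "?e j \<in> forms d" for j
      using forms_mult[OF var_in_forms linear_form_power_in_forms, of j v "d - 1"] d by simp
    have "apair h (G k) = (\<Sum>j\<in>UNIV. coords k h $ j * apair (?e j) (G k))" for k
    proof -
      have "apair h (G k) = (\<Sum>t\<in>UNIV. \<Sum>j\<in>UNIV. c k t * (U k $ t $ j * coords k h $ j))"
        using h by (simp add: G peval_point[symmetric] sum_distrib_left)
      also have "\<dots> = (\<Sum>j\<in>UNIV. \<Sum>t\<in>UNIV. c k t * (U k $ t $ j * coords k h $ j))"
        by (rule sum.swap)
      also have "\<dots> = (\<Sum>j\<in>UNIV. coords k h $ j * apair (?e j) (G k))"
        by (simp add: G[OF e] U(1) sum_distrib_left ac_simps del: One_nat_def)
      finally show ?thesis .
    qed
    moreover have "(\<lambda>k. \<Sum>j\<in>UNIV. coords k h $ j * apair (?e j) (G k))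
        \<longlonglongrightarrow> (\<Sum>j\<in>UNIV. coords_lim h $ j * apair (?e j) F)"
      by (intro tendsto_intros apair_tendsto G_lim coords_tendsto)
    moreover have "coords_lim h = 0"
      using h limit_ideal_form by blast
    ultimately have "(\<lambda>k. apair h (G k)) \<longlonglongrightarrow> 0"
      by simp
    then have "apair h F = 0"
      using LIMSEQ_unique apair_tendsto[OF G_lim] by blast
    then show ?thesis
      using diff_act_same_degree_eq_0_iff h F_forms by blast
  qed
  then have "F \<in> linear_span d limit_ideal"
    using F_forms by (simp add: linear_span_def)
  then show ?thesis
    using smoothable_scheme_limit_ideal by blast
qed

theorem mainTheorem1:
  fixes d :: nat and F :: "'n::finite cpoly"
  assumes "d \<ge> 3"
    and "F \<in> forms d"
    and "concise F"
    and "border_rank d F = CARD('n)"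
  shows "(Hess F = 0 \<longleftrightarrow> cactus_rank d F > border_rank d F) \<and>
         (cactus_rank d F > border_rank d F \<longleftrightarrow> smoothable_rank d F > border_rank d F) \<and>
         (smoothable_rank d F > border_rank d F \<longleftrightarrow> wild d F)"
proof -
  let ?cactus = "\<lambda>r. \<exists>J. zero_dim_scheme r J \<and> F \<in> linear_span d J"
  let ?smoothable = "\<lambda>r. \<exists>J. smoothable_scheme r J \<and> F \<in> linear_span d J"
  have smoothable_cactus: "?cactus r" if "?smoothable r" for r
    using that by (auto simp: smoothable_scheme_def)
  have "Hess F = 0 \<longleftrightarrow> cactus_rank d F > CARD('n)" "Hess F = 0 \<longleftrightarrow> smoothable_rank d F > CARD('n)"
  proof -
    have small: "cactus_rank d F \<le> CARD('n) \<and> smoothable_rank d F \<le> CARD('n)" if "Hess F \<noteq> 0"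
    proof -
      have "F \<in> secant_variety CARD('n) d"
        using in_secant_variety_border_rank[OF assms(2)] assms(4) by simp
      then have "?smoothable CARD('n)"
        using smoothable_scheme_of_Hess_nonzero[OF assms(1)] that by blast
      then show ?thesis
        using smoothable_cactus[of "CARD('n)"] unfolding cactus_rank_def smoothable_rank_def
        by (auto intro!: Least_le)
    qed
    have large: "cactus_rank d F > CARD('n) \<and> smoothable_rank d F > CARD('n)" if "Hess F = 0"
    proof -
      have no_cactus: "r > CARD('n)" if r: "?cactus r" for r
      proof (rule ccontr)
        assume "\<not> r > CARD('n)"
        moreover obtain J where "zero_dim_scheme r J" "F \<in> linear_span d J"
          using r by blast
        ultimately show False
          using Hess_nonzero_of_short_scheme[OF _ assms(2,3), of r J] \<open>Hess F = 0\<close> assms(1) by simp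
      qed
      \<comment> \<open>One admissible length makes both \<open>LEAST\<close> values admissible, so
        the bound valid for all cactus schemes applies to both ranks.\<close>
      obtain r where r: "?smoothable r"
        using exists_smoothable_scheme[OF assms(2)] by blast
      have "?smoothable (smoothable_rank d F)"
        unfolding smoothable_rank_def using r by (rule LeastI)
      moreover have "?cactus (cactus_rank d F)"
        unfolding cactus_rank_def using smoothable_cactus[OF r] by (rule LeastI)
      ultimately show ?thesis
        using no_cactus smoothable_cactus by blast
    qed
    show "Hess F = 0 \<longleftrightarrow> cactus_rank d F > CARD('n)" "Hess F = 0 \<longleftrightarrow> smoothable_rank d F > CARD('n)"
      using small large by (metis not_le)+
  qed
  then show ?thesis
    using assms(4) by (simp add: wild_def)
qed

end
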